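(* Let $n\ge1$, $T>0$, $\alpha\ge0$, $\Lambda$ symmetric positive definite, $\Sigma$ symmetric nonnegative definite, $\theta_1,\dots,\theta_n\ge0$, and for $l>l_0$ let $C(l,\cdot)$ be the unique solution on $(-\infty,T]$ of $C'=C^\top\Lambda^{-1}C+C^\top\tilde CC-\alpha\Sigma$, $C(T)=lI$, $\tilde C=\operatorname{diag}(\theta_i/c_{i,i})$. Let $t\in[0,T)$. (i) The entrywise limit $C(t):=\lim_{l\to\infty}C(l,t)$ exists on $[0,T)$, and $C(l,\cdot)$ converges to $C$ uniformly on compact subsets of $[0,T)$. Furthermore $\lim_{l\to\infty}c_{\min}(l,T)=\infty$, where $c_{\min}(l,T)$ is the smallest eigenvalue of $C(l,T)$. (ii) $C$ solves $C'=C^\top\Lambda^{-1}C+C^\top\tilde CC-\alpha\Sigma$ on $[0,T)$ (with $\tilde C=\operatorname{diag}(\theta_i/c_{i,i})$ built from the entries of $C$), with boundary condition $\lim_{s\to T-}c_{\min}(s)=\infty$, where $c_{\min}(s)$ is the smallest eigenvalue of $C(s)$. Moreover $$0<P(t)\le\sqrt{\Lambda^{-1}}\,C(t)\,\sqrt{\Lambda^{-1}}\le Q(t),$$ where $P(t):=\lim_{l\to\infty}P(l,t)$ and $Q(t):=\lim_{l\to\infty}Q(l,t)$, with $P(l,\cdot),Q(l,\cdot)$ the solutions of $P'=P^2+\theta P-\alpha d_{\min}I$, $P(T)=\frac{l}{\lambda_{\max}}I$, and $Q'=Q^2-\alpha d_{\max}I$, $Q(T)=\frac{l}{\lambda_{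\min}}I$.
   Context: $\theta=\sum_i\theta_i$; $D=\sqrt{\Lambda^{-1}}\Sigma\sqrt{\Lambda^{-1}}$ with smallest/largest eigenvalues $d_{\min},d_{\max}$; $\lambda_{\min},\lambda_{\max}$ the smallest/largest eigenvalues of $\Lambda$; $l_0:=\max\{\lambda_{\max}(\sqrt{\theta^2/4+\alpha d_{\min}}-\theta/2),\ \lambda_{\min}\sqrt{\alpha d_{\max}}\}$. For $l>l_0$ the matrix initial value problem has a unique symmetric solution on $(-\infty,T]$ (so $C(l,t)$ is well defined). For symmetric $A,B$, $A\le B$ means $B-A$ nonnegative definite. $P(l,t)$ and $Q(l,t)$ are scalar multiples of the identity, and their limits as $l\to\infty$ exist for $t<T$. *)

theory Defs
  imports "HOL-Analysis.Analysis"
begin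

type_synonym 'n sqmat = "real ^ 'n ^ 'n"

definition sym_mat :: "'n::finite sqmat \<Rightarrow> bool" where
  "sym_mat A \<longleftrightarrow> transpose A = A"

definition pos_def :: "'n::finite sqmat \<Rightarrow> bool" where
  "pos_def A \<longleftrightarrow> sym_mat A \<and> (\<forall>x. x \<noteq> 0 \<longrightarrow> x \<bullet> (A *v x) > 0)"

definition nonneg_def :: "'n::finite sqmat \<Rightarrow> bool" where
  "nonneg_def A \<longleftrightarrow> sym_mat A \<and> (\<forall>x. x \<bullet> (A *v x) \<ge> 0)"

definition loewner_le :: "'n::finite sqmat \<Rightarrow> 'n sqmat \<Rightarrow> bool" where
  "loewner_le A B \<longleftrightarrow> sym_mat A \<and> sym_mat B \<and> nonneg_def (B - A)"

definition mat_eigenvalues :: "'n::finite sqmat \<Rightarrow> real set" where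
  "mat_eigenvalues A = {\<mu>. \<exists>v. v \<noteq> 0 \<and> A *v v = \<mu> *s v}"

definition min_eig :: "'n::finite sqmat \<Rightarrow> real" where
  "min_eig A = Min (mat_eigenvalues A)"

definition max_eig :: "'n::finite sqmat \<Rightarrow> real" where
  "max_eig A = Max (mat_eigenvalues A)"

definition msqrt :: "'n::finite sqmat \<Rightarrow> 'n sqmat" where
  "msqrt A = (THE B. nonneg_def B \<and> B ** B = A)"

definition Dmat :: "'n::finite sqmat \<Rightarrow> 'n sqmat \<Rightarrow> 'n sqmat" where
  "Dmat Lam Sig = msqrt (matrix_inv Lam) ** Sig ** msqrt (matrix_inv Lam)"

definition Ctilde :: "real ^ 'n \<Rightarrow> 'n::finite sqmat \<Rightarrow> 'n sqmat" where
  "Ctilde \<theta> C = (\<chi> i j. if i = j then \<theta> $ i / C $ i $ i else 0)"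

definition riccati_rhs :: "real \<Rightarrow> 'n::finite sqmat \<Rightarrow> 'n sqmat \<Rightarrow> real ^ 'n \<Rightarrow> 'n sqmat \<Rightarrow> 'n sqmat" where
  "riccati_rhs \<alpha> Lam Sig \<theta> C =
     transpose C ** matrix_inv Lam ** C + transpose C ** Ctilde \<theta> C ** C - \<alpha> *\<^sub>R Sig"

definition l0 :: "real \<Rightarrow> 'n::finite sqmat \<Rightarrow> 'n sqmat \<Rightarrow> real ^ 'n \<Rightarrow> real" where
  "l0 \<alpha> Lam Sig \<theta> =
     (let th = (\<Sum>i\<in>UNIV. \<theta> $ i); D = Dmat Lam Sig in
      max (max_eig Lam * (sqrt (th\<^sup>2 / 4 + \<alpha> * min_eig D) - th / 2))
          (min_eig Lam * sqrt (\<alpha> * max_eig D)))"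

end

theory Submission
  imports Defs
begin

text \<open>
  Everything rests on one comparison principle: a positive definite subsolution lying below a
  supersolution at the terminal time lies below it at all earlier times. Applied to \<open>p \<Lambda>\<close> and \<open>q \<Lambda>\<close>
  with scalar solutions \<open>p\<close>, \<open>q\<close>, it gives \<open>p \<Lambda> \<le> C(l,\<cdot>) \<le> q \<Lambda>\<close>. Applied to two members of the
  family, it gives monotonicity in \<open>l\<close>. Since the equation is autonomous, it also gives
  \<open>C(l',t) \<le> C(l,t+\<delta>)\<close> for all \<open>l' \<ge> l\<close> as soon as \<open>l\<close> dominates the bound \<open>q \<Lambda>\<close> at time \<open>T-\<delta>\<close>. As the
  \<open>C(l,\<cdot>)\<close> are uniformly Lipschitz away from \<open>T\<close>, the family is uniformly Cauchy there, and the
  equation passes to the limit.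
\<close>

section \<open>Symmetric matrices\<close>

text \<open>The barriers come from the ray of multiples of \<open>Lam\<close>: there
  \<open>matrix_inv Lam\<close> cancels, the \<theta>-part is nonnegative and by Cauchy-Schwarz at
  most \<open>th\<close> times the form of \<open>Lam\<close>, and \<open>Sig\<close> lies between
  \<open>min_eig (Dmat Lam Sig)\<close> and \<open>max_eig (Dmat Lam Sig)\<close> times
  \<open>Lam\<close>. This produces exactly the scalar equations behind P and Q, and
  \<open>l0\<close> is the threshold above which both terminal values exceed the equilibria of these
  equations, so that p and q stay positive backwards in time. The obstacle is the denominator
  \<open>C $ i $ i\<close>: the right-hand side is well behaved only where the diagonal is positive.
  The lower barrier provides this, so it must be in place before C can act as the smaller function
  in a comparison. The upper barrier decays in backward time at a rate that does not depend on l: q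
  is at most \<open>rQ + 1 / (T - t)\<close>. All estimates uniform in l away from T rest on this.
  The shift then gives uniform convergence with an explicit threshold, where monotonicity and
  boundedness alone would give a pointwise limit.\<close>

lemma nonneg_form_zero_imp_ker:
  fixes g :: "'a::euclidean_space \<Rightarrow> 'a"
  assumes lin: "linear g" and adj: "\<And>x y. g x \<bullet> y = x \<bullet> g y"
    and S: "subspace S" "g ` S \<subseteq> S"
    and nn: "\<And>x. x \<in> S \<Longrightarrow> x \<bullet> g x \<ge> 0"
    and v: "v \<in> S" "v \<bullet> g v = 0"
  shows "g v = 0"
proof (rule ccontr)
  assume "g v \<noteq> 0"
  define w where "w = g v"
  define k where "k = w \<bullet> g w"
  have wS: "w \<in> S" using v S by (auto simp: w_def)
  have k0: "k \<ge> 0" using nn[OF wS] by (simp add: k_def)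
  have w0: "w \<bullet> w > 0" using \<open>g v \<noteq> 0\<close> by (simp add: w_def)
  \<comment> \<open>Moving from v by \<open>- s *\<^sub>R w\<close> changes the form by
    \<open>s * (s * k - 2 * (w \<bullet> w))\<close>. This s keeps \<open>s * k\<close> below
    \<open>w \<bullet> w\<close>, which makes the change negative; the summand 1 covers the case k =
    0.\<close>
  define s where "s = (w \<bullet> w) / (1 + k)"
  have s0: "s > 0" using w0 k0 by (simp add: s_def)
  have "v - s *\<^sub>R w \<in> S" using v wS S by (intro subspace_diff subspace_mul)
  from nn[OF this] have "0 \<le> (v - s *\<^sub>R w) \<bullet> (g v - s *\<^sub>R g w)"
    by (simp add: linear_diff[OF lin] linear_scale[OF lin])
  also have "\<dots> = s * (s * k - 2 * (w \<bullet> w))"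
    using v(2) adj[of v w] unfolding k_def w_def[symmetric]
    by (simp add: inner_diff_left inner_diff_right inner_commute algebra_simps)
  finally have "s * k \<ge> 2 * (w \<bullet> w)" using s0 by (simp add: zero_le_mult_iff)
  moreover have "s * (1 + k) = w \<bullet> w" using k0 by (simp add: s_def)
  ultimately show False using s0 w0 by (simp add: algebra_simps)
qed

text \<open>The quotient of \<open>x \<bullet> f x\<close> by \<open>x \<bullet> x\<close> attains
  its maximum \<mu> on the unit sphere of S by compactness. At a maximiser the nonnegative form of
  \<mu> minus f vanishes, so the maximiser lies in the kernel. The restriction to an invariant
  subspace serves the induction for the eigenbasis.\<close>

lemma selfadjoint_max_eigenvector:
  fixes f :: "'a::euclidean_space \<Rightarrow> 'a"
  assumes lin: "linear f" and adj: "\<And>x y. f x \<bullet> y = x \<bullet> f y"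
    and S: "subspace S" "f ` S \<subseteq> S" "S \<noteq> {0}"
  obtains v \<mu> where "v \<in> S" "norm v = 1" "f v = \<mu> *\<^sub>R v" "\<And>x. x \<in> S \<Longrightarrow> x \<bullet> f x \<le> \<mu> * (x \<bullet> x)"
proof -
  let ?U = "S \<inter> sphere 0 1"
  have "compact ?U"
    using closed_subspace[OF S(1)] by (simp add: closed_Int_compact)
  moreover have "?U \<noteq> {}"
  proof -
    obtain x where "x \<in> S" "x \<noteq> 0" using S subspace_0 by blast
    then have "x /\<^sub>R norm x \<in> ?U" using S by (auto intro: subspace_mul)
    then show ?thesis by blast
  qed
  moreover have "continuous_on ?U (\<lambda>x. x \<bullet> f x)"
    using linear_continuous_on[OF linear_conv_bounded_linear[THEN iffD1, OF lin]]
    by (intro continuous_intros)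
  ultimately obtain v where v: "v \<in> ?U" and vmax: "\<And>x. x \<in> ?U \<Longrightarrow> x \<bullet> f x \<le> v \<bullet> f v"
    using continuous_attains_sup[of ?U "\<lambda>x. x \<bullet> f x"] by blast
  define \<mu> where "\<mu> = v \<bullet> f v"
  have le: "x \<bullet> f x \<le> \<mu> * (x \<bullet> x)" if "x \<in> S" for x
  proof (cases "x = 0")
    case False
    have "x /\<^sub>R norm x \<in> ?U" using S that False by (auto intro: subspace_mul)
    from vmax[OF this] have "(x \<bullet> f x) / (norm x)\<^sup>2 \<le> \<mu>"
      by (simp add: linear_scale[OF lin] \<mu>_def divide_inverse power2_eq_square mult_ac)
    then show ?thesis using False by (simp add: dot_square_norm field_simps)
  qed (simp add: linear_0[OF lin])
  define g where "g = (\<lambda>x. \<mu> *\<^sub>R x - f x)"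
  have "linear g" unfolding g_def
    by (rule linearI) (simp_all add: linear_add[OF lin] linear_scale[OF lin] algebra_simps)
  moreover have "g x \<bullet> y = x \<bullet> g y" for x y using adj[of x y] by (simp add: g_def inner_diff_left inner_diff_right)
  moreover have "g ` S \<subseteq> S"
  proof safe
    fix x assume "x \<in> S"
    then show "g x \<in> S" unfolding g_def using S by (intro subspace_diff subspace_mul) auto
  qed
  moreover have "x \<bullet> g x \<ge> 0" if "x \<in> S" for x using le[OF that] by (simp add: g_def inner_diff_right)
  moreover have "v \<bullet> g v = 0" using v by (simp add: g_def inner_diff_right \<mu>_def dot_square_norm)
  ultimately have "g v = 0" using nonneg_form_zero_imp_ker[of g S v] S(1) v by simp
  then show thesis using that[of v \<mu>] v le by (simp add: g_def)
qed

text \<open>Induction on the dimension: self-adjointness makes the orthogonal complement of an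
  eigenvector invariant. The basis is what the square root behind \<open>msqrt\<close> is built
  from.\<close>

lemma selfadjoint_orthonormal_eigenbasis:
  fixes f :: "'a::euclidean_space \<Rightarrow> 'a"
  assumes lin: "linear f" and adj: "\<And>x y. f x \<bullet> y = x \<bullet> f y"
  shows "subspace S \<Longrightarrow> f ` S \<subseteq> S \<Longrightarrow>
    \<exists>B. pairwise orthogonal B \<and> (\<forall>b\<in>B. norm b = 1 \<and> (\<exists>\<mu>. f b = \<mu> *\<^sub>R b)) \<and> span B = S"
proof (induction "dim S" arbitrary: S rule: less_induct)
  case less
  show ?case
  proof (cases "S = {0}")
    case True
    then show ?thesis by (intro exI[of _ "{}"]) auto
  next
    case False
    obtain v \<mu> where v: "v \<in> S" "norm v = 1" "f v = \<mu> *\<^sub>R v"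
      using selfadjoint_max_eigenvector[OF lin adj less.prems False] by metis
    define S' where "S' = S \<inter> {x. v \<bullet> x = 0}"
    have sub: "subspace S'"
      unfolding S'_def by (intro subspace_inter less.prems subspace_hyperplane)
    have inv: "f ` S' \<subseteq> S'"
    proof safe
      fix x assume x: "x \<in> S'"
      have "v \<bullet> f x = f v \<bullet> x" by (simp add: adj)
      also have "\<dots> = 0" using x v by (simp add: S'_def)
      finally show "f x \<in> S'" using x less.prems by (auto simp: S'_def)
    qed
    have "v \<notin> S'" using v by (auto simp: S'_def)
    then have "S' \<subset> S" using v(1) S'_def by blast
    then have "dim S' < dim S"
      using dim_psubset[of S' S] sub less.prems by (simp add: span_eq_iff[THEN iffD2])
    from less.hyps[OF this sub inv] obtain B where
      B: "pairwise orthogonal B" "\<And>b. b \<in> B \<Longrightarrow> norm b = 1 \<and> (\<exists>\<mu>. f b = \<mu> *\<^sub>R b)" "span B = S'"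
      by auto
    have orth: "v \<bullet> b = 0" if "b \<in> B" for b
      using span_base[OF that] unfolding B(3) S'_def by simp
    have "pairwise orthogonal (insert v B)"
      using B(1) orth by (auto simp: pairwise_insert orthogonal_def inner_commute)
    moreover have "\<forall>b\<in>insert v B. norm b = 1 \<and> (\<exists>\<mu>. f b = \<mu> *\<^sub>R b)"
      using B(2) v by blast
    moreover have "span (insert v B) = S"
    proof
      have "B \<subseteq> S" using B(3) \<open>S' \<subset> S\<close> span_superset by blast
      then show "span (insert v B) \<subseteq> S"
        using v less.prems by (simp add: span_minimal)
      show "S \<subseteq> span (insert v B)"
      proof
        fix x assume x: "x \<in> S"
        have "x - (v \<bullet> x) *\<^sub>R v \<in> S'"
          using x v less.prems by (auto simp: S'_def inner_diff_right dot_square_norm intro!: subspace_diff subspace_mul)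
        then show "x \<in> span (insert v B)"
          using B(3) span_breakdown_eq by blast
      qed
    qed
    ultimately show ?thesis by blast
  qed
qed

section \<open>Extreme eigenvalues as bounds of quadratic forms\<close>

lemma sym_mat_inner: "sym_mat A \<Longrightarrow> (A *v x) \<bullet> y = x \<bullet> (A *v y)"
  using dot_lmul_matrix[of x A y] by (simp add: sym_mat_def transpose_matrix_vector[symmetric])

lemma sym_mat_iff_inner: "sym_mat A \<longleftrightarrow> (\<forall>x y. (A *v x) \<bullet> y = x \<bullet> (A *v y))"
proof
  assume R: "\<forall>x y. (A *v x) \<bullet> y = x \<bullet> (A *v y)"
  have "(transpose A *v x) \<bullet> y = (A *v x) \<bullet> y" for x y
    using R by (simp add: dot_lmul_matrix transpose_matrix_vector)
  then show "sym_mat A" unfolding sym_mat_def matrix_eq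
    using vector_eq_rdot by blast
qed (simp add: sym_mat_inner)

lemma sym_mat_max_eigenvector:
  fixes A :: "'n::finite sqmat"
  assumes "sym_mat A"
  obtains v \<mu> where "norm v = 1" "A *v v = \<mu> *s v" "\<And>x. x \<bullet> (A *v x) \<le> \<mu> * (x \<bullet> x)"
proof -
  have "UNIV \<noteq> {0::real^'n}"
    by (metis UNIV_I axis_eq_0_iff singletonD zero_neq_one)
  then obtain v \<mu> where "norm v = 1" "A *v v = \<mu> *\<^sub>R v" "\<And>x. x \<bullet> (A *v x) \<le> \<mu> * (x \<bullet> x)"
    using selfadjoint_max_eigenvector[of "(*v) A" UNIV] sym_mat_inner[OF assms]
    by (metis UNIV_I matrix_vector_mul_linear subset_UNIV subspace_UNIV)
  then show thesis using that[of v \<mu>] by (simp add: scalar_mult_eq_scaleR)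
qed

text \<open>\<open>Min\<close> and \<open>Max\<close> are specified only on finite nonempty sets, so
  \<open>min_eig\<close> and \<open>max_eig\<close> depend on this. One chosen eigenvector per
  eigenvalue gives a pairwise orthogonal, hence independent, hence finite family.\<close>

lemma finite_eigenvalues:
  assumes A: "sym_mat A"
  shows "finite (mat_eigenvalues A)"
proof -
  define v where "v \<mu> = (SOME v. v \<noteq> 0 \<and> A *v v = \<mu> *s v)" for \<mu>
  have v: "v \<mu> \<noteq> 0" "A *v (v \<mu>) = \<mu> *s v \<mu>" if "\<mu> \<in> mat_eigenvalues A" for \<mu>
    using someI_ex[of "\<lambda>v. v \<noteq> 0 \<and> A *v v = \<mu> *s v"] that unfolding mat_eigenvalues_def v_def by auto
  have orth: "v \<mu> \<bullet> v \<nu> = 0" if "\<mu> \<in> mat_eigenvalues A" "\<nu> \<in> mat_eigenvalues A" "\<mu> \<noteq> \<nu>" for \<mu> \<nu>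
    using sym_mat_inner[OF A, of "v \<mu>" "v \<nu>"] v that by (simp add: scalar_mult_eq_scaleR)
  have inj: "inj_on v (mat_eigenvalues A)"
  proof (rule inj_onI, rule ccontr)
    fix \<mu> \<nu> assume *: "\<mu> \<in> mat_eigenvalues A" "\<nu> \<in> mat_eigenvalues A" "v \<mu> = v \<nu>" "\<mu> \<noteq> \<nu>"
    then show False using orth[of \<mu> \<nu>] v(1)[of \<mu>] by simp
  qed
  have "independent (v ` mat_eigenvalues A)"
  proof (rule pairwise_orthogonal_independent)
    show "pairwise orthogonal (v ` mat_eigenvalues A)"
      unfolding pairwise_def orthogonal_def using orth by blast
    show "0 \<notin> v ` mat_eigenvalues A" using v(1) by fastforce
  qed
  then show ?thesis using finite_imageD[OF _ inj] independent_imp_finite by blast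
qed

lemma max_eig_eigenvector:
  assumes A: "sym_mat A"
  obtains v where "norm v = 1" "A *v v = max_eig A *s v" "\<And>x. x \<bullet> (A *v x) \<le> max_eig A * (x \<bullet> x)"
proof -
  obtain v \<mu> where v: "norm v = 1" "A *v v = \<mu> *s v" "\<And>x. x \<bullet> (A *v x) \<le> \<mu> * (x \<bullet> x)"
    using sym_mat_max_eigenvector[OF A] by metis
  have "max_eig A = \<mu>" unfolding max_eig_def
  proof (rule Max_eqI[OF finite_eigenvalues[OF A]])
    show "\<mu> \<in> mat_eigenvalues A"
    proof -
      have "v \<noteq> 0" using v(1) by auto
      then show ?thesis unfolding mat_eigenvalues_def using v(2) by blast
    qed
    fix \<nu> assume "\<nu> \<in> mat_eigenvalues A"
    then obtain w where w: "w \<noteq> 0" "A *v w = \<nu> *s w" unfolding mat_eigenvalues_def by blast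
    then show "\<nu> \<le> \<mu>" using v(3)[of w] by (simp add: scalar_mult_eq_scaleR)
  qed
  then show thesis using that v by blast
qed

lemma matrix_vector_mult_minus: "(- A) *v x = - (A *v x)" for A :: "real^'n^'m"
  using matrix_vector_mult_diff_rdistrib[of 0 A x] by simp

lemma sym_mat_uminus: "sym_mat A \<Longrightarrow> sym_mat (- A)"
  by (simp add: sym_mat_iff_inner matrix_vector_mult_minus)

lemma min_eig_eigenvector:
  assumes A: "sym_mat A"
  obtains v where "norm v = 1" "A *v v = min_eig A *s v" "\<And>x. min_eig A * (x \<bullet> x) \<le> x \<bullet> (A *v x)"
proof -
  \<comment> \<open>The minimum of the quadratic form on unit vectors is minus the maximum for
    \<open>- A\<close>.\<close>
  obtain v \<mu> where v: "norm v = 1" "(-A) *v v = \<mu> *s v" "\<And>x. x \<bullet> ((-A) *v x) \<le> \<mu> * (x \<bullet> x)"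
    using sym_mat_max_eigenvector[OF sym_mat_uminus[OF A]] by metis
  have le: "(-\<mu>) * (x \<bullet> x) \<le> x \<bullet> (A *v x)" for x using v(3)[of x] by (simp add: matrix_vector_mult_minus)
  have eig: "A *v v = (-\<mu>) *s v"
    using v(2) by (simp add: scalar_mult_eq_scaleR matrix_vector_mult_minus minus_equation_iff[of "A *v v"])
  have "min_eig A = -\<mu>" unfolding min_eig_def
  proof (rule Min_eqI[OF finite_eigenvalues[OF A]])
    show "-\<mu> \<in> mat_eigenvalues A"
    proof -
      have "v \<noteq> 0" using v(1) by auto
      then show ?thesis unfolding mat_eigenvalues_def using eig by blast
    qed
    fix \<nu> assume "\<nu> \<in> mat_eigenvalues A"
    then obtain w where w: "w \<noteq> 0" "A *v w = \<nu> *s w" unfolding mat_eigenvalues_def by blast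
    then have "(-\<mu>) * (w \<bullet> w) \<le> \<nu> * (w \<bullet> w)" using le[of w] by (simp add: scalar_mult_eq_scaleR)
    then show "-\<mu> \<le> \<nu>" using w(1) by (simp only: mult_le_cancel_right inner_gt_zero_iff) auto
  qed
  then show thesis using that[OF v(1)] le eig by simp
qed

text \<open>\<open>msqrt\<close> is a definite description, so existence and uniqueness are both
  required. A nonnegative root must multiply each eigenvector b of A by \<open>sqrt (m b)\<close>;
  since the eigenvectors span, this determines the root and also tells how to define it.\<close>

lemma nonneg_def_unique_sqrt:
  fixes A :: "'n::finite sqmat"
  assumes A: "nonneg_def A"
  shows "\<exists>!R. nonneg_def R \<and> R ** R = A"
proof -
  have sA: "sym_mat A" and nn: "\<And>x. x \<bullet> (A *v x) \<ge> 0" using A by (auto simp: nonneg_def_def)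
  obtain B where B: "pairwise orthogonal B" "\<And>b. b \<in> B \<Longrightarrow> norm b = 1"
      "\<And>b. b \<in> B \<Longrightarrow> \<exists>\<mu>. A *v b = \<mu> *\<^sub>R b" "span B = UNIV"
    using selfadjoint_orthonormal_eigenbasis[of "(*v) A" UNIV] sym_mat_inner[OF sA] by auto
  have fin: "finite B"
    using B pairwise_orthogonal_independent[OF B(1)] independent_imp_finite by fastforce
  obtain m where m: "\<And>b. b \<in> B \<Longrightarrow> A *v b = m b *\<^sub>R b" using B(3) by metis
  have m0: "m b \<ge> 0" if "b \<in> B" for b
    using nn[of b] m[OF that] B(2)[OF that] by (simp add: dot_square_norm)
  have ext: "M = N" if "\<And>b. b \<in> B \<Longrightarrow> M *v b = N *v b" for M N :: "'n sqmat"
    unfolding matrix_eq using linear_eq_on_span[of "(*v) M" "(*v) N" B] that B(4) by auto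
  have root_eig: "R *v b = sqrt (m b) *\<^sub>R b" if R: "nonneg_def R" "R ** R = A" and b: "b \<in> B" for R b
  proof -
    have sR: "sym_mat R" and nR: "\<And>x. x \<bullet> (R *v x) \<ge> 0" using R by (auto simp: nonneg_def_def)
    \<comment> \<open>R maps w to \<open>- sqrt (m b) *\<^sub>R w\<close>, which nonnegativity of R
      permits only for w = 0 if m b is positive. If m b = 0, the squared norm of
      \<open>R *v b\<close> is \<open>b \<bullet> (A *v b) = 0\<close>.\<close>
    define w where "w = R *v b - sqrt (m b) *\<^sub>R b"
    have RR: "R *v (R *v b) = m b *\<^sub>R b" using m[OF b] R(2) by (simp add: matrix_vector_mul_assoc)
    have "R *v w = - sqrt (m b) *\<^sub>R w"
      using m0[OF b] by (simp add: w_def matrix_vector_mult_diff_distrib matrix_vector_mult_scaleR RR algebra_simps)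
    then have "sqrt (m b) * (w \<bullet> w) \<le> 0" using nR[of w] by simp
    show ?thesis
    proof (cases "m b = 0")
      case True
      then have "(R *v b) \<bullet> (R *v b) = 0" using sym_mat_inner[OF sR, of b "R *v b"] RR by simp
      then show ?thesis using True by simp
    next
      case False
      then have "sqrt (m b) > 0" using m0[OF b] by simp
      then have "w \<bullet> w \<le> 0" using \<open>sqrt (m b) * (w \<bullet> w) \<le> 0\<close> by (simp add: mult_le_0_iff)
      then have "w = 0" by (metis inner_eq_zero_iff inner_ge_zero order_antisym)
      then show ?thesis by (simp add: w_def)
    qed
  qed
  define f where "f = (\<lambda>x::real^'n. \<Sum>b\<in>B. (sqrt (m b) * (x \<bullet> b)) *\<^sub>R b)"
  have lf: "linear f" unfolding f_def
    by (rule linearI) (simp_all add: inner_add_left algebra_simps sum.distrib scaleR_sum_right)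
  define R where "R = matrix f"
  have Rf: "R *v x = f x" for x by (simp add: R_def matrix_works lf linear_matrix_vector_mul_eq)
  have inner_f: "f x \<bullet> y = (\<Sum>b\<in>B. sqrt (m b) * (x \<bullet> b) * (y \<bullet> b))" for x y
    unfolding f_def by (simp add: inner_sum_left inner_commute[of y])
  have "f x \<bullet> y = x \<bullet> f y" for x y
    unfolding inner_f inner_commute[of x "f y"] by (rule sum.cong) (simp_all add: mult_ac)
  moreover have "x \<bullet> f x \<ge> 0" for x
    unfolding inner_commute[of x "f x"] inner_f using m0 by (auto simp: mult.assoc intro!: sum_nonneg)
  ultimately have "nonneg_def R" unfolding nonneg_def_def sym_mat_iff_inner Rf by blast
  have fb: "f b = sqrt (m b) *\<^sub>R b" if b: "b \<in> B" for b
  proof -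
    have "(sqrt (m c) * (b \<bullet> c)) *\<^sub>R c = (if c = b then sqrt (m b) *\<^sub>R b else 0)" if "c \<in> B" for c
      using B(1) B(2)[OF b] b that by (auto simp: pairwise_def orthogonal_def dot_square_norm)
    then show ?thesis using fin b by (simp add: f_def)
  qed
  have "R ** R = A"
    by (rule ext) (simp add: m m0 Rf fb matrix_vector_mul_assoc[symmetric] linear_scale[OF lf])
  show ?thesis
  proof (rule ex1I[of _ R])
    show "nonneg_def R \<and> R ** R = A" using \<open>nonneg_def R\<close> \<open>R ** R = A\<close> by simp
    show "R' = R" if "nonneg_def R' \<and> R' ** R' = A" for R'
      by (rule ext) (use that root_eig \<open>nonneg_def R\<close> \<open>R ** R = A\<close> in simp)
  qed
qed

lemma
  assumes "nonneg_def A"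
  shows msqrt_nonneg_def: "nonneg_def (msqrt A)"
    and msqrt_square: "msqrt A ** msqrt A = A"
  using theI'[OF nonneg_def_unique_sqrt[OF assms]] unfolding msqrt_def by blast+

lemma pos_def_imp_nonneg_def: "pos_def A \<Longrightarrow> nonneg_def A"
  unfolding pos_def_def nonneg_def_def by (metis inner_zero_left less_imp_le order_refl)

lemma pos_def_inverse:
  fixes A :: "'n::finite sqmat"
  assumes A: "pos_def A"
  shows "A ** matrix_inv A = mat 1" "matrix_inv A ** A = mat 1" "pos_def (matrix_inv A)"
proof -
  have "x = 0" if "A *v x = 0" for x
    using A that unfolding pos_def_def by (metis inner_zero_right less_irrefl)
  then obtain B where "B ** A = mat 1" using matrix_left_invertible_ker[of A] by blast
  then have "invertible A" unfolding invertible_def using matrix_left_right_inverse by blast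
  then have inv: "A ** matrix_inv A = mat 1 \<and> matrix_inv A ** A = mat 1"
    unfolding invertible_def matrix_inv_def by (rule someI_ex)
  then show 1: "A ** matrix_inv A = mat 1" and 2: "matrix_inv A ** A = mat 1" by auto
  have AI: "A *v (matrix_inv A *v x) = x" for x by (simp add: matrix_vector_mul_assoc 1)
  have sA: "sym_mat A" using A by (simp add: pos_def_def)
  show "pos_def (matrix_inv A)" unfolding pos_def_def sym_mat_iff_inner
  proof (intro conjI allI impI)
    fix x y :: "real^'n"
    show "(matrix_inv A *v x) \<bullet> y = x \<bullet> (matrix_inv A *v y)"
      using sym_mat_inner[OF sA, of "matrix_inv A *v x" "matrix_inv A *v y"] by (simp add: AI)
  next
    fix x :: "real^'n" assume "x \<noteq> 0"
    then have "matrix_inv A *v x \<noteq> 0" by (metis AI matrix_vector_mult_0_right)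
    then show "0 < x \<bullet> (matrix_inv A *v x)"
      using A AI[of x] unfolding pos_def_def by (metis inner_commute)
  qed
qed

section \<open>Comparison principle\<close>

lemma bounded_linear_quadratic_form: "bounded_linear (\<lambda>A::real^'n^'n. x \<bullet> (A *v x))"
  by (intro linear_conv_bounded_linear[THEN iffD1] linearI)
     (simp_all add: matrix_vector_mult_add_rdistrib inner_add_right scaleR_matrix_vector_assoc[symmetric])

lemma matrix_vector_mult_scaled: "(c *\<^sub>R A) *v x = c *\<^sub>R (A *v x)" for A :: "real^'n^'m"
  by (simp add: scaleR_matrix_vector_assoc)

lemma quadratic_form_diff: "x \<bullet> ((A - B) *v x) = x \<bullet> (A *v x) - x \<bullet> (B *v x)" for A :: "real^'n^'n"
  by (simp add: matrix_vector_mult_diff_rdistrib inner_diff_right)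

lemma quadratic_form_scale: "x \<bullet> ((c *\<^sub>R A) *v x) = c * (x \<bullet> (A *v x))" for A :: "real^'n^'n"
  by (simp add: matrix_vector_mult_scaled)

lemma quadratic_form_axis: "axis i 1 \<bullet> (A *v axis i 1) = A $ i $ i" for A :: "real^'n^'n"
  by (simp add: inner_axis' matrix_vector_mul_component inner_axis)

lemma sym_mat_diff: "sym_mat A \<Longrightarrow> sym_mat B \<Longrightarrow> sym_mat (A - B)"
  by (simp add: sym_mat_iff_inner matrix_vector_mult_diff_rdistrib inner_diff_left inner_diff_right)

lemma sym_mat_scaleR: "sym_mat A \<Longrightarrow> sym_mat (c *\<^sub>R A)"
  by (simp add: sym_mat_iff_inner matrix_vector_mult_scaled)

lemma quadratic_form_riccati_rhs:
  assumes "sym_mat C"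
  shows "x \<bullet> (riccati_rhs \<alpha> Lam Sig \<theta> C *v x) =
    (C *v x) \<bullet> (matrix_inv Lam *v (C *v x)) + (\<Sum>i\<in>UNIV. \<theta> $ i / C $ i $ i * ((C *v x) $ i)\<^sup>2) - \<alpha> * (x \<bullet> (Sig *v x))"
proof -
  have tr: "transpose C = C" using assms by (simp add: sym_mat_def)
  have row: "(Ctilde \<theta> C *v y) $ i = \<theta> $ i / C $ i $ i * y $ i" for y i
    by (simp add: Ctilde_def matrix_vector_mult_def if_distrib if_distribR cong: if_cong)
  have "x \<bullet> ((C ** M ** C) *v x) = (C *v x) \<bullet> (M *v (C *v x))" for M
    by (simp add: matrix_vector_mul_assoc[symmetric] sym_mat_inner[OF assms])
  moreover have "(C *v x) \<bullet> (Ctilde \<theta> C *v (C *v x)) = (\<Sum>i\<in>UNIV. \<theta> $ i / C $ i $ i * ((C *v x) $ i)\<^sup>2)"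
    by (simp add: inner_vec_def row power2_eq_square mult_ac)
  ultimately show ?thesis
    by (simp add: riccati_rhs_def tr matrix_vector_mult_add_rdistrib matrix_vector_mult_diff_rdistrib
        inner_add_right inner_diff_right matrix_vector_mult_scaled)
qed

lemma nonneg_def_zero_imp_ker:
  assumes "nonneg_def A" "x \<bullet> (A *v x) = 0"
  shows "A *v x = 0"
  by (rule nonneg_form_zero_imp_ker[of _ UNIV])
     (use assms sym_mat_inner[of A] in \<open>auto simp: nonneg_def_def\<close>)

text \<open>At the latest time s where positivity fails, the form is nonnegative by continuity from
  the right, so it has a kernel vector x. The negative derivative at x would push the form below
  zero just after s, where it is still positive.\<close>

lemma pos_def_backward:
  fixes Z :: "real \<Rightarrow> real^'n::finite^'n"
  assumes sym: "\<And>t. t \<in> {a..b} \<Longrightarrow> sym_mat (Z t)"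
    and deriv: "\<And>t. t \<in> {a..b} \<Longrightarrow> (Z has_vector_derivative Z' t) (at t within {a..b})"
    and final: "pos_def (Z b)"
    and neg: "\<And>t x. t \<in> {a..b} \<Longrightarrow> nonneg_def (Z t) \<Longrightarrow> x \<noteq> 0 \<Longrightarrow> Z t *v x = 0 \<Longrightarrow> x \<bullet> (Z' t *v x) < 0"
    and t: "t \<in> {a..b}"
  shows "pos_def (Z t)"
proof (rule ccontr)
  assume np: "\<not> pos_def (Z t)"
  \<comment> \<open>Failures are recorded as pairs of a time and a unit vector. Normalising the
    vector makes the set of failures compact, so that a latest time exists.\<close>
  define q where "q = (\<lambda>(s, x). x \<bullet> (Z s *v x))"
  have contZ: "continuous_on {a..b} Z"
    using deriv by (meson continuous_on_eq_continuous_within has_vector_derivative_continuous)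
  have contZ': "continuous_on ({a..b} \<times> sphere 0 1) (\<lambda>z::real \<times> (real^'n). Z (fst z))"
    by (rule continuous_on_compose2[OF contZ continuous_on_fst]) (auto intro: continuous_intros)
  have "continuous_on ({a..b} \<times> sphere 0 1) q"
    unfolding q_def case_prod_beta' inner_vec_def matrix_vector_mult_def
    by (auto intro!: continuous_intros contZ')
  then have "closedin (top_of_set ({a..b} \<times> sphere 0 1)) (({a..b} \<times> sphere 0 1) \<inter> q -` {..0})"
    by (rule continuous_closedin_preimage) auto
  then have cK: "compact (({a..b} \<times> sphere 0 1) \<inter> q -` {..0})" (is "compact ?K")
    by (rule closedin_compact[rotated]) (intro compact_Times compact_Icc compact_sphere)
  have K: "(s, x /\<^sub>R norm x) \<in> ?K" if "s \<in> {a..b}" "x \<noteq> 0" "x \<bullet> (Z s *v x) \<le> 0" for s x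
    using that by (auto simp: q_def matrix_vector_mult_scaleR mult_nonneg_nonpos)
  have "?K \<noteq> {}"
    using np sym[OF t] K[OF t] unfolding pos_def_def by (metis empty_iff linorder_not_less)
  then obtain z where z: "z \<in> ?K" and zmax: "\<And>y. y \<in> ?K \<Longrightarrow> fst y \<le> fst z"
    using continuous_attains_sup[OF cK _ continuous_on_fst[OF continuous_on_id]] by auto
  obtain s x where sx: "z = (s, x)" by force
  have s: "s \<in> {a..b}" and x0: "x \<noteq> 0" and le: "x \<bullet> (Z s *v x) \<le> 0"
    using z by (auto simp: sx q_def)
  have pos: "y \<bullet> (Z r *v y) > 0" if "r \<in> {a..b}" "r > s" "y \<noteq> 0" for r y
    using K[OF that(1,3)] zmax[of "(r, y /\<^sub>R norm y)"] that sx by force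
  have "s \<noteq> b" using final le x0 unfolding pos_def_def by force
  then have sb: "s < b" using s by auto
  have dq: "((\<lambda>r. y \<bullet> (Z r *v y)) has_vector_derivative y \<bullet> (Z' s *v y)) (at s within {a..b})" for y
    using bounded_linear.has_vector_derivative[OF bounded_linear_quadratic_form deriv[OF s]] .
  have "y \<bullet> (Z s *v y) \<ge> 0" for y
  proof (cases "y = 0")
    case False
    have "((\<lambda>r. y \<bullet> (Z r *v y)) \<longlongrightarrow> y \<bullet> (Z s *v y)) (at s within {a..b})"
      using has_vector_derivative_continuous[OF dq] by (simp add: continuous_within)
    then have "((\<lambda>r. y \<bullet> (Z r *v y)) \<longlongrightarrow> y \<bullet> (Z s *v y)) (at s within {s<..<b})"
      by (rule tendsto_within_subset) (use s in auto)
    moreover have "\<forall>\<^sub>F r in at s within {s<..<b}. 0 \<le> y \<bullet> (Z r *v y)"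
      unfolding eventually_at_filter using pos False s by (auto intro!: always_eventually less_imp_le)
    moreover have "at s within {s<..<b} \<noteq> bot"
      using sb by (simp add: at_within_eq_bot_iff)
    ultimately show ?thesis by (rule tendsto_lowerbound)
  qed simp
  then have nn: "nonneg_def (Z s)" using sym[OF s] by (simp add: nonneg_def_def)
  then have zero: "x \<bullet> (Z s *v x) = 0" using le by (auto simp: nonneg_def_def intro: antisym)
  then have "x \<bullet> (Z' s *v x) < 0" using neg[OF s nn x0] nonneg_def_zero_imp_ker[OF nn] by blast
  moreover have "((\<lambda>r. x \<bullet> (Z r *v x)) has_real_derivative x \<bullet> (Z' s *v x)) (at s within {a..b})"
    using dq by (simp add: has_real_derivative_iff_has_vector_derivative)
  ultimately obtain d where d: "d > 0"
      "\<And>h. h > 0 \<Longrightarrow> s + h \<in> {a..b} \<Longrightarrow> h < d \<Longrightarrow> x \<bullet> (Z (s + h) *v x) < x \<bullet> (Z s *v x)"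
    using has_real_derivative_neg_dec_right by blast
  define h where "h = min (d / 2) (b - s)"
  have "h > 0" "h < d" "s + h \<in> {a..b}" using d(1) sb s by (auto simp: h_def min_def)
  then show False using d(2)[of h] pos[of "s + h" x] x0 zero by simp
qed

text \<open>If \<open>X\<close> is a positive definite subsolution and \<open>0 < \<kappa> < 1\<close>, then \<open>\<kappa> X\<close> is a strict subsolution, because
  the right-hand side is a quadratic part plus a part that is homogeneous of degree one minus a
  nonnegative constant. Moreover the right-hand side is quasimonotone: where \<open>Y - \<kappa> X \<ge> 0\<close> annihilates
  \<open>x\<close>, both quadratic forms at \<open>x\<close> only differ through the diagonal entries in the denominators.\<close>

lemma riccati_comparison:
  fixes X Y :: "real \<Rightarrow> real^'n::finite^'n"
  assumes \<alpha>: "\<alpha> \<ge> 0" and Lam: "pos_def Lam" and Sig: "nonneg_def Sig" and \<theta>: "\<And>i. \<theta> $ i \<ge> 0"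
    and posX: "\<And>t. t \<in> {a..b} \<Longrightarrow> pos_def (X t)"
    and symY: "\<And>t. t \<in> {a..b} \<Longrightarrow> sym_mat (Y t)"
    and dX: "\<And>t. t \<in> {a..b} \<Longrightarrow> (X has_vector_derivative X' t) (at t within {a..b})"
    and dY: "\<And>t. t \<in> {a..b} \<Longrightarrow> (Y has_vector_derivative Y' t) (at t within {a..b})"
    and subX: "\<And>t x. t \<in> {a..b} \<Longrightarrow> x \<bullet> (riccati_rhs \<alpha> Lam Sig \<theta> (X t) *v x) \<le> x \<bullet> (X' t *v x)"
    and supY: "\<And>t x. t \<in> {a..b} \<Longrightarrow> x \<bullet> (Y' t *v x) \<le> x \<bullet> (riccati_rhs \<alpha> Lam Sig \<theta> (Y t) *v x)"
    and final: "\<And>x. x \<bullet> (X b *v x) \<le> x \<bullet> (Y b *v x)"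
    and t: "t \<in> {a..b}"
  shows "x \<bullet> (X t *v x) \<le> x \<bullet> (Y t *v x)"
proof -
  have symX: "sym_mat (X t)" if "t \<in> {a..b}" for t using posX[OF that] by (simp add: pos_def_def)
  have strict: "pos_def (Y t - \<kappa> *\<^sub>R X t)" if \<kappa>: "0 < \<kappa>" "\<kappa> < 1" for \<kappa>
  proof (rule pos_def_backward[where a = a and b = b and Z' = "\<lambda>t. Y' t - \<kappa> *\<^sub>R X' t"])
    show "sym_mat (Y s - \<kappa> *\<^sub>R X s)" if "s \<in> {a..b}" for s
      using symX[OF that] symY[OF that] by (intro sym_mat_diff sym_mat_scaleR)
    then have "sym_mat (Y b - \<kappa> *\<^sub>R X b)" using t by simp
    moreover have "0 < x \<bullet> ((Y b - \<kappa> *\<^sub>R X b) *v x)" if "x \<noteq> 0" for x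
    proof -
      have "x \<bullet> (X b *v x) > 0" using posX[of b] t that by (simp add: pos_def_def)
      then have "\<kappa> * (x \<bullet> (X b *v x)) < x \<bullet> (X b *v x)" using \<kappa> by simp
      then show ?thesis using final[of x] by (simp add: quadratic_form_diff quadratic_form_scale)
    qed
    ultimately show "pos_def (Y b - \<kappa> *\<^sub>R X b)" by (simp add: pos_def_def)
    show "((\<lambda>t. Y t - \<kappa> *\<^sub>R X t) has_vector_derivative Y' s - \<kappa> *\<^sub>R X' s) (at s within {a..b})"
      if "s \<in> {a..b}" for s
      using dX[OF that] dY[OF that]
      by (intro has_vector_derivative_diff bounded_linear.has_vector_derivative[OF bounded_linear_scaleR_right])
    show "x \<bullet> ((Y' s - \<kappa> *\<^sub>R X' s) *v x) < 0"
      if s: "s \<in> {a..b}" and nn: "nonneg_def (Y s - \<kappa> *\<^sub>R X s)" and x: "x \<noteq> 0"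
        and ker: "(Y s - \<kappa> *\<^sub>R X s) *v x = 0" for s x
    proof -
      define w where "w = X s *v x"
      define k where "k = w \<bullet> (matrix_inv Lam *v w)"
      define m where "m = x \<bullet> (Sig *v x)"
      have Yx: "Y s *v x = \<kappa> *\<^sub>R w"
        using ker by (simp add: matrix_vector_mult_diff_rdistrib matrix_vector_mult_scaled w_def)
      have Xpos: "pos_def (X s)" using posX[OF s] .
      have "x \<bullet> w > 0" using Xpos x by (simp add: pos_def_def w_def)
      then have "w \<noteq> 0" by auto
      then have k: "k > 0" using pos_def_inverse(3)[OF Lam] by (simp add: k_def pos_def_def)
      have m: "m \<ge> 0" using Sig by (simp add: m_def nonneg_def_def)
      \<comment> \<open>Nonnegativity of \<open>Y s - \<kappa> *\<^sub>R X s\<close> on the axes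
        bounds the diagonal of Y below by \<kappa> times that of X. This also makes it positive,
        although Y is only assumed symmetric. The remaining factor is \<kappa> squared over
        \<kappa>, that is, homogeneity of degree one.\<close>
      have diag: "\<theta> $ i / Y s $ i $ i * (\<kappa> * w $ i)\<^sup>2 \<le> \<kappa> * (\<theta> $ i / X s $ i $ i * (w $ i)\<^sup>2)" for i
      proof -
        have "0 < axis i 1 \<bullet> (X s *v axis i 1)"
          using Xpos unfolding pos_def_def by (metis axis_eq_0_iff zero_neq_one)
        then have Xi: "X s $ i $ i > 0" by (simp only: quadratic_form_axis)
        have "0 \<le> axis i 1 \<bullet> ((Y s - \<kappa> *\<^sub>R X s) *v axis i 1)"
          using nn by (simp add: nonneg_def_def)
        then have Yi: "\<kappa> * X s $ i $ i \<le> Y s $ i $ i" by (simp only: quadratic_form_axis) simp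
        have "\<theta> $ i / Y s $ i $ i * (\<kappa> * w $ i)\<^sup>2 \<le> \<theta> $ i / (\<kappa> * X s $ i $ i) * (\<kappa> * w $ i)\<^sup>2"
          using Yi Xi \<kappa> \<theta>[of i] by (intro mult_right_mono divide_left_mono mult_pos_pos) (auto intro: less_le_trans[OF mult_pos_pos])
        also have "\<dots> = \<kappa> * (\<theta> $ i / X s $ i $ i * (w $ i)\<^sup>2)"
          using \<kappa> Xi by (simp add: field_simps power2_eq_square)
        finally show ?thesis .
      qed
      have "x \<bullet> ((Y' s - \<kappa> *\<^sub>R X' s) *v x) \<le> x \<bullet> (riccati_rhs \<alpha> Lam Sig \<theta> (Y s) *v x) - \<kappa> * (x \<bullet> (riccati_rhs \<alpha> Lam Sig \<theta> (X s) *v x))"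
        using supY[OF s, of x] subX[OF s, of x] \<kappa>
        by (simp add: quadratic_form_diff quadratic_form_scale add_mono diff_mono)
      also have "\<dots> = (\<kappa> * \<kappa> * k + (\<Sum>i\<in>UNIV. \<theta> $ i / Y s $ i $ i * (\<kappa> * w $ i)\<^sup>2) - \<alpha> * m)
          - \<kappa> * (k + (\<Sum>i\<in>UNIV. \<theta> $ i / X s $ i $ i * (w $ i)\<^sup>2) - \<alpha> * m)"
        unfolding quadratic_form_riccati_rhs[OF symX[OF s]] quadratic_form_riccati_rhs[OF symY[OF s]]
          Yx w_def[symmetric] k_def m_def
        by (simp add: matrix_vector_mult_scaleR mult.assoc)
      \<comment> \<open>The \<theta>-sums cancel up to sign by \<open>diag\<close>. The quadratic
        part leaves \<kappa> squared minus \<kappa> times k, which gives strictness because k > 0;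
        the constant part has the favourable sign.\<close>
      also have "\<dots> \<le> - (\<kappa> * (1 - \<kappa>) * k) - (1 - \<kappa>) * (\<alpha> * m)"
        using sum_mono[of UNIV, OF diag] by (simp add: sum_distrib_left algebra_simps)
      also have "\<dots> < 0"
      proof -
        have "\<kappa> * (1 - \<kappa>) * k > 0" "(1 - \<kappa>) * (\<alpha> * m) \<ge> 0" using \<kappa> k m \<alpha> by auto
        then show ?thesis by linarith
      qed
      finally show ?thesis .
    qed
  qed (rule t)
  have le: "\<kappa> * (x \<bullet> (X t *v x)) \<le> x \<bullet> (Y t *v x)" if "0 < \<kappa>" "\<kappa> < 1" for \<kappa>
  proof -
    have "0 \<le> x \<bullet> ((Y t - \<kappa> *\<^sub>R X t) *v x)"
      using pos_def_imp_nonneg_def[OF strict[OF that]] by (simp add: nonneg_def_def)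
    then show ?thesis by (simp add: quadratic_form_diff quadratic_form_scale)
  qed
  \<comment> \<open>Strictness was obtained for every \<kappa> < 1; the weak inequality is the limit
    as \<kappa> tends to 1.\<close>
  show ?thesis by (rule field_le_mult_one_interval) (rule le)
qed

section \<open>Scalar Riccati equations\<close>

text \<open>The solution of y'' = \<open>r\<^sup>2\<close> y with y(0) = 0 and y'(0) = 1. The branch
  at r = 0 is the limit of the other one and covers degenerate data such as \<alpha> = 0 in
  \<open>rQ\<close>.\<close>

definition sinhc :: "real \<Rightarrow> real \<Rightarrow> real" where
  "sinhc r s = (if r = 0 then s else sinh (r * s) / r)"

text \<open>In reversed time \<open>s\<close> the equation \<open>u' = r\<^sup>2 - u\<^sup>2\<close> is linearised by \<open>u = y' / y\<close> with \<open>y'' = r\<^sup>2 y\<close>.\<close>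

definition riccati_sol :: "real \<Rightarrow> real \<Rightarrow> real \<Rightarrow> real" where
  "riccati_sol r u s = (r\<^sup>2 * sinhc r s + u * cosh (r * s)) / (cosh (r * s) + u * sinhc r s)"

lemma sinhc_has_derivative: "(sinhc r has_real_derivative cosh (r * s)) (at s within S)"
proof (cases "r = 0")
  case True
  then have "sinhc r = (\<lambda>s. s)" by (auto simp: sinhc_def)
  then show ?thesis using True by (auto intro!: derivative_eq_intros)
next
  case False
  then have "sinhc r = (\<lambda>s. sinh (r * s) / r)" by (auto simp: sinhc_def)
  then show ?thesis using False by (auto intro!: derivative_eq_intros)
qed

lemma cosh_has_derivative_sinhc: "((\<lambda>s. cosh (r * s)) has_real_derivative r\<^sup>2 * sinhc r s) (at s within S)"
  by (auto intro!: derivative_eq_intros simp: sinhc_def power2_eq_square)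

lemma cosh_minus_sinhc: "cosh (r * s) - r * sinhc r s = exp (- (r * s))"
  using cosh_minus_sinh[of "r * s"] by (auto simp: sinhc_def)

lemma sinh_ge: "x \<le> sinh x" if "0 \<le> x" for x :: real
proof -
  have "sinh 0 - 0 \<le> sinh x - x"
  proof (rule DERIV_nonneg_imp_nondecreasing[OF that])
    fix y :: real
    show "\<exists>z. ((\<lambda>x. sinh x - x) has_real_derivative z) (at y) \<and> 0 \<le> z"
      using cosh_real_ge_1[of y] by (intro exI[of _ "cosh y - 1"]) (auto intro!: derivative_eq_intros)
  qed
  then show ?thesis by simp
qed

lemma sinhc_ge:
  assumes "0 \<le> r" "0 \<le> s"
  shows "s \<le> sinhc r s"
proof (cases "r = 0")
  case False
  then show ?thesis using sinh_ge[of "r * s"] assms by (simp add: sinhc_def field_simps)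
qed (simp add: sinhc_def)

lemma riccati_sol_0: "riccati_sol r u 0 = u"
  by (simp add: riccati_sol_def sinhc_def)

lemma riccati_sol_denom_pos:
  assumes "0 \<le> r" "0 \<le> u" "0 \<le> s"
  shows "0 < cosh (r * s) + u * sinhc r s"
proof -
  have "0 \<le> u * sinhc r s" using sinhc_ge[OF assms(1,3)] assms by simp
  then show ?thesis using cosh_real_pos[of "r * s"] by linarith
qed

lemma riccati_sol_has_derivative:
  assumes "0 \<le> r" "0 \<le> u" "0 \<le> s"
  shows "(riccati_sol r u has_real_derivative r\<^sup>2 - (riccati_sol r u s)\<^sup>2) (at s within S)"
proof -
  define c h where "c = cosh (r * s)" and "h = sinhc r s"
  have d: "c + u * h \<noteq> 0" using riccati_sol_denom_pos[OF assms] by (simp add: c_def h_def)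
  have 1: "((\<lambda>s. r\<^sup>2 * sinhc r s + u * cosh (r * s)) has_real_derivative r\<^sup>2 * c + u * (r\<^sup>2 * h)) (at s within S)"
    unfolding c_def h_def by (intro DERIV_add DERIV_cmult sinhc_has_derivative cosh_has_derivative_sinhc)
  have 2: "((\<lambda>s. cosh (r * s) + u * sinhc r s) has_real_derivative r\<^sup>2 * h + u * c) (at s within S)"
    unfolding c_def h_def by (intro DERIV_add DERIV_cmult sinhc_has_derivative cosh_has_derivative_sinhc)
  have "(riccati_sol r u has_real_derivative
      ((r\<^sup>2 * c + u * (r\<^sup>2 * h)) * (c + u * h) - (r\<^sup>2 * h + u * c) * (r\<^sup>2 * h + u * c)) / ((c + u * h) * (c + u * h))) (at s within S)"
    using DERIV_divide[OF 1 2] d unfolding riccati_sol_def c_def h_def by simp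
  also have "((r\<^sup>2 * c + u * (r\<^sup>2 * h)) * (c + u * h) - (r\<^sup>2 * h + u * c) * (r\<^sup>2 * h + u * c)) / ((c + u * h) * (c + u * h))
      = r\<^sup>2 - (riccati_sol r u s)\<^sup>2"
  proof -
    have "(r\<^sup>2 * c + u * (r\<^sup>2 * h)) * (c + u * h) = r\<^sup>2 * ((c + u * h) * (c + u * h))"
      by (simp add: algebra_simps)
    then show ?thesis
      using d unfolding riccati_sol_def c_def[symmetric] h_def[symmetric]
      by (simp add: diff_divide_distrib power2_eq_square)
  qed
  finally show ?thesis .
qed

text \<open>Numerator minus r times denominator factors as (u - r) exp(- r s): a solution starting
  above the equilibrium r never reaches it.\<close>

lemma riccati_sol_gt:
  assumes "0 \<le> r" "r < u" "0 \<le> s"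
  shows "r < riccati_sol r u s"
proof -
  have pos: "0 < cosh (r * s) + u * sinhc r s" using assms by (intro riccati_sol_denom_pos) auto
  have "(u - r) * (cosh (r * s) - r * sinhc r s) > 0" using assms by (simp add: cosh_minus_sinhc)
  then have "r * (cosh (r * s) + u * sinhc r s) < r\<^sup>2 * sinhc r s + u * cosh (r * s)"
    by (simp add: algebra_simps power2_eq_square)
  then show ?thesis using pos by (simp add: riccati_sol_def pos_less_divide_eq)
qed

text \<open>The bound does not depend on the initial value u, because the term
  \<open>- u\<^sup>2\<close> brings solutions down from arbitrarily large values. After clearing the
  denominator, the coefficient of u is h / s - exp(- r s), which is nonnegative since h / s is at
  least 1.\<close>

lemma riccati_sol_le:
  assumes "0 \<le> r" "0 \<le> u" "0 < s"
  shows "riccati_sol r u s \<le> r + 1 / s"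
proof -
  define c h where "c = cosh (r * s)" and "h = sinhc r s"
  have pos: "0 < c + u * h" unfolding c_def h_def using assms by (intro riccati_sol_denom_pos) auto
  have c: "c - r * h = exp (- (r * s))" by (simp add: c_def h_def cosh_minus_sinhc)
  have "h \<ge> s" using assms by (simp add: h_def sinhc_ge)
  then have "1 \<le> h / s" using assms by simp
  then have "c - r * h \<le> h / s" using c assms by (smt (verit) exp_le_one_iff mult_nonneg_nonneg)
  then have "u * (c - r * h) \<le> u * (h / s)" using assms by (intro mult_left_mono)
  moreover have "0 \<le> r * (c - r * h)" using c assms by simp
  moreover have "0 \<le> c / s" using assms by (simp add: c_def cosh_real_nonneg)
  ultimately have "r\<^sup>2 * h + u * c \<le> (r + 1 / s) * (c + u * h)"
    by (simp add: algebra_simps power2_eq_square)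
  then show ?thesis using pos by (simp add: riccati_sol_def c_def h_def pos_divide_le_eq)
qed

text \<open>The limit is the solution coming down from infinity: r coth(r s) for positive r, and 1 /
  s for r = 0. It is read off after dividing numerator and denominator by u.\<close>

lemma riccati_sol_tendsto:
  assumes "0 \<le> r" "0 < s"
  shows "((\<lambda>u. riccati_sol r u s) \<longlongrightarrow> cosh (r * s) / sinhc r s) at_top"
proof -
  define c h where "c = cosh (r * s)" and "h = sinhc r s"
  have h: "h > 0" using sinhc_ge[of r s] assms by (simp add: h_def)
  have "((\<lambda>u. (r\<^sup>2 * h * inverse u + c) / (c * inverse u + h)) \<longlongrightarrow> (r\<^sup>2 * h * 0 + c) / (c * 0 + h)) at_top"
    using h by (intro tendsto_intros tendsto_inverse_0_at_top filterlim_ident) auto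
  moreover have "\<forall>\<^sub>F u in at_top. (r\<^sup>2 * h * inverse u + c) / (c * inverse u + h) = riccati_sol r u s"
    using eventually_gt_at_top[of "0::real"]
  proof eventually_elim
    case (elim u)
    have "(r\<^sup>2 * h * inverse u + c) / (c * inverse u + h) = ((r\<^sup>2 * h + u * c) / u) / ((c + u * h) / u)"
      using elim by (simp add: field_simps)
    also have "\<dots> = (r\<^sup>2 * h + u * c) / (c + u * h)" using elim by simp
    finally show ?case by (simp add: riccati_sol_def c_def h_def)
  qed
  ultimately have "((\<lambda>u. riccati_sol r u s) \<longlongrightarrow> (r\<^sup>2 * h * 0 + c) / (c * 0 + h)) at_top"
    by (rule Lim_transform_eventually)
  then show ?thesis by (simp add: c_def h_def)
qed

lemma riccati_limit_gt:
  assumes "0 \<le> r" "0 < s"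
  shows "r < cosh (r * s) / sinhc r s"
proof -
  have "sinhc r s > 0" using sinhc_ge[of r s] assms by simp
  moreover have "r * sinhc r s < cosh (r * s)" using cosh_minus_sinhc[of r s] by (smt (verit) exp_gt_zero)
  ultimately show ?thesis by (simp add: pos_less_divide_eq)
qed

section \<open>Uniqueness for matrix Riccati equations with scalar data\<close>

lemma bounded_bilinear_matrix_mult: "bounded_bilinear ((**) :: real^'n^'m \<Rightarrow> real^'k^'n \<Rightarrow> real^'k^'m)"
  unfolding bilinear_conv_bounded_bilinear[symmetric] bilinear_def
  by (auto intro!: linearI simp: matrix_matrix_mult_def vec_eq_iff sum.distrib algebra_simps sum_distrib_left scaleR_sum_right)

text \<open>Gronwall argument from the terminal time: with K bounding the growth rate of E, the
  weight exp(2 K s) makes the squared norm nondecreasing, so its value at t is at most its value 0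
  at b.\<close>

lemma linear_matrix_ode_zero:
  fixes E M :: "real \<Rightarrow> real^'n::finite^'n"
  assumes dE: "\<And>t. t \<in> {a..b} \<Longrightarrow> (E has_vector_derivative M t ** E t) (at t within {a..b})"
    and contM: "continuous_on {a..b} M" and Eb: "E b = 0" and t: "t \<in> {a..b}"
  shows "E t = 0"
proof -
  obtain L where L: "\<And>(A::real^'n^'n) (B::real^'n^'n). norm (A ** B) \<le> norm A * norm B * L" and "L > 0"
    using bounded_bilinear.pos_bounded[OF bounded_bilinear_matrix_mult] by blast
  obtain m where m: "\<And>s. s \<in> {a..b} \<Longrightarrow> norm (M s) \<le> m"
    using compact_imp_bounded[OF compact_continuous_image[OF contM compact_Icc]]
    unfolding bounded_iff by blast
  define K where "K = m * L"
  define \<phi> where "\<phi> s = exp (2 * K * s) * (E s \<bullet> E s)" for s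
  have contE: "continuous_on {a..b} E"
    using dE by (meson continuous_on_eq_continuous_within has_vector_derivative_continuous)
  have "\<phi> t \<le> \<phi> b"
  proof (rule DERIV_nonneg_imp_increasing_open[where f = \<phi>])
    show "t \<le> b" using t by simp
    show "continuous_on {t..b} \<phi>"
      unfolding \<phi>_def by (intro continuous_intros continuous_on_subset[OF contE]) (use t in auto)
    fix s assume s: "t < s" "s < b"
    have "(E has_vector_derivative M s ** E s) (at s within {a..b})" using s t by (intro dE) auto
    then have d: "(E has_vector_derivative M s ** E s) (at s)"
      using s t at_within_interior[of s "{a..b}"] by simp
    have "(\<phi> has_real_derivative 2 * K * exp (2 * K * s) * (E s \<bullet> E s) + exp (2 * K * s) * (2 * (E s \<bullet> (M s ** E s)))) (at s)"
    proof -
      have "((\<lambda>s. E s \<bullet> E s) has_vector_derivative (E s \<bullet> (M s ** E s) + (M s ** E s) \<bullet> E s)) (at s)"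
        by (rule bounded_bilinear.has_vector_derivative[OF bounded_bilinear_inner d d])
      then have "((\<lambda>s. E s \<bullet> E s) has_real_derivative 2 * (E s \<bullet> (M s ** E s))) (at s)"
        by (simp add: has_real_derivative_iff_has_vector_derivative inner_commute)
      then show ?thesis unfolding \<phi>_def by (auto intro!: derivative_eq_intros)
    qed
    moreover have "0 \<le> 2 * K * exp (2 * K * s) * (E s \<bullet> E s) + exp (2 * K * s) * (2 * (E s \<bullet> (M s ** E s)))"
    proof -
      have "\<bar>E s \<bullet> (M s ** E s)\<bar> \<le> norm (E s) * norm (M s ** E s)" by (rule Cauchy_Schwarz_ineq2)
      also have "\<dots> \<le> norm (E s) * (norm (M s) * norm (E s) * L)" by (intro mult_left_mono L norm_ge_zero)
      also have "\<dots> \<le> norm (E s) * (m * norm (E s) * L)"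
        using m[of s] s t \<open>L > 0\<close> by (intro mult_left_mono mult_right_mono) auto
      also have "\<dots> = K * (E s \<bullet> E s)" by (simp add: K_def dot_square_norm power2_eq_square)
      finally have "0 \<le> K * (E s \<bullet> E s) + E s \<bullet> (M s ** E s)" by linarith
      then have "0 \<le> (2 * exp (2 * K * s)) * (K * (E s \<bullet> E s) + E s \<bullet> (M s ** E s))" by simp
      then show ?thesis by (simp add: algebra_simps)
    qed
    ultimately show "\<exists>y. (\<phi> has_real_derivative y) (at s) \<and> 0 \<le> y" by blast
  qed
  then have "exp (2 * K * t) * (E t \<bullet> E t) \<le> 0" by (simp add: \<phi>_def Eb)
  then have "E t \<bullet> E t \<le> 0" by (simp add: mult_le_0_iff)
  then show ?thesis by (metis inner_eq_zero_iff inner_ge_zero order_antisym)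
qed

text \<open>P is just some matrix solution, not known to be scalar. Since multiples of the identity
  commute with P, the difference of squares factors and the error solves a linear equation with zero
  terminal value.\<close>

lemma matrix_riccati_scalar_solution:
  fixes P :: "real \<Rightarrow> real^'n::finite^'n" and p :: "real \<Rightarrow> real"
  assumes dP: "\<And>t. t \<le> T \<Longrightarrow> (P has_vector_derivative P t ** P t + c *\<^sub>R P t - k *\<^sub>R mat 1) (at t within {..T})"
    and dp: "\<And>t. t \<le> T \<Longrightarrow> (p has_real_derivative (p t)\<^sup>2 + c * p t - k) (at t within {..T})"
    and final: "P T = p T *\<^sub>R mat 1" and t: "t \<le> T"
  shows "P t = p t *\<^sub>R mat 1"
proof -
  define E where "E s = P s - p s *\<^sub>R mat 1" for s
  define M where "M s = P s + (p s + c) *\<^sub>R mat 1" for s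
  have "E t = 0"
  proof (rule linear_matrix_ode_zero[where a = t and b = T and M = M])
    have cP: "continuous_on {t..T} P" and cp: "continuous_on {t..T} p"
      unfolding continuous_on_eq_continuous_within
      by (auto intro: continuous_within_subset[OF has_vector_derivative_continuous[OF dP]]
          continuous_within_subset[OF DERIV_continuous[OF dp]])
    then show "continuous_on {t..T} M" unfolding M_def by (intro continuous_intros)
    fix s assume s: "s \<in> {t..T}"
    have "(p has_vector_derivative (p s)\<^sup>2 + c * p s - k) (at s within {t..T})"
      using s dp[of s] unfolding has_real_derivative_iff_has_vector_derivative
      by (auto elim: has_vector_derivative_within_subset)
    then have "((\<lambda>s. p s *\<^sub>R (mat 1 :: real^'n^'n)) has_vector_derivative ((p s)\<^sup>2 + c * p s - k) *\<^sub>R mat 1) (at s within {t..T})"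
      by (rule bounded_linear.has_vector_derivative[OF bounded_linear_scaleR_left])
    moreover have "(P has_vector_derivative P s ** P s + c *\<^sub>R P s - k *\<^sub>R mat 1) (at s within {t..T})"
      by (rule has_vector_derivative_within_subset[OF dP]) (use s in auto)
    ultimately have "(E has_vector_derivative P s ** P s + c *\<^sub>R P s - k *\<^sub>R mat 1 - ((p s)\<^sup>2 + c * p s - k) *\<^sub>R mat 1) (at s within {t..T})"
      unfolding E_def by (intro has_vector_derivative_diff)
    also have "P s ** P s + c *\<^sub>R P s - k *\<^sub>R mat 1 - ((p s)\<^sup>2 + c * p s - k) *\<^sub>R mat 1 = M s ** E s"
      unfolding M_def E_def
      by (simp add: bounded_bilinear.add_left[OF bounded_bilinear_matrix_mult] bounded_bilinear.diff_right[OF bounded_bilinear_matrix_mult]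
          bounded_bilinear.scaleR_left[OF bounded_bilinear_matrix_mult] bounded_bilinear.scaleR_right[OF bounded_bilinear_matrix_mult]
          algebra_simps power2_eq_square)
    finally show "(E has_vector_derivative M s ** E s) (at s within {t..T})" .
  qed (use t final in \<open>auto simp: E_def\<close>)
  then show ?thesis by (simp add: E_def)
qed

section \<open>Matrix inequalities\<close>

text \<open>Cauchy-Schwarz for the inner product given by A, applied to x and an axis vector. With A
  = \<open>Lam\<close> it turns the \<theta>-part into at most \<open>th\<close> times the form of
  \<open>Lam\<close>.\<close>

lemma pos_def_cauchy_schwarz_axis:
  assumes "pos_def A"
  shows "((A *v x) $ i)\<^sup>2 / A $ i $ i \<le> x \<bullet> (A *v x)"
proof -
  have sym: "sym_mat A" using assms by (simp add: pos_def_def)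
  have "0 < axis i 1 \<bullet> (A *v axis i 1)"
    using assms unfolding pos_def_def by (metis axis_eq_0_iff zero_neq_one)
  then have Ai: "A $ i $ i > 0" by (simp only: quadratic_form_axis)
  \<comment> \<open>This c minimises the form along the line
    \<open>x - c *\<^sub>R e\<close>.\<close>
  define c where "c = (A *v x) $ i / A $ i $ i"
  define e :: "real^'a" where "e = axis i 1"
  have ex: "e \<bullet> (A *v x) = (A *v x) $ i" by (simp add: e_def inner_axis')
  have xe: "x \<bullet> (A *v e) = (A *v x) $ i" using sym_mat_inner[OF sym, of x e] ex by (simp add: inner_commute)
  have ee: "e \<bullet> (A *v e) = A $ i $ i" by (simp add: e_def quadratic_form_axis)
  have "0 \<le> (x - c *\<^sub>R e) \<bullet> (A *v (x - c *\<^sub>R e))"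
    using pos_def_imp_nonneg_def[OF assms] by (simp add: nonneg_def_def)
  also have "\<dots> = x \<bullet> (A *v x) - 2 * c * (A *v x) $ i + c\<^sup>2 * A $ i $ i"
    by (simp add: matrix_vector_mult_diff_distrib matrix_vector_mult_scaleR inner_diff_left inner_diff_right
        ex xe ee power2_eq_square algebra_simps)
  also have "\<dots> = x \<bullet> (A *v x) - ((A *v x) $ i)\<^sup>2 / A $ i $ i"
    using Ai by (simp add: c_def power2_eq_square)
  finally show ?thesis by simp
qed

lemma norm_matrix_le_entries:
  fixes A :: "real^'n::finite^'m::finite"
  assumes "\<And>i j. \<bar>A $ i $ j\<bar> \<le> c"
  shows "norm A \<le> real CARD('m) * (real CARD('n) * c)"
proof -
  have "norm A \<le> (\<Sum>i\<in>UNIV. norm (A $ i))"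
    unfolding norm_vec_def by (rule L2_set_le_sum) simp
  also have "\<dots> \<le> (\<Sum>i\<in>(UNIV::'m set). real CARD('n) * c)"
  proof (rule sum_mono)
    fix i
    have "norm (A $ i) \<le> (\<Sum>j\<in>UNIV. \<bar>A $ i $ j\<bar>)" by (rule norm_le_l1_cart)
    also have "\<dots> \<le> (\<Sum>j\<in>(UNIV::'n set). c)" using assms by (intro sum_mono) auto
    finally show "norm (A $ i) \<le> real CARD('n) * c" by simp
  qed
  finally show ?thesis by simp
qed

text \<open>Polarisation bounds each entry by c, and the norm is bounded by the sum of the entries.
  This converts two-sided bounds on forms into norm estimates.\<close>

lemma norm_nonneg_form_le:
  fixes A :: "real^'n::finite^'n"
  assumes A: "sym_mat A" and nn: "\<And>x. 0 \<le> x \<bullet> (A *v x)" and le: "\<And>x. x \<bullet> (A *v x) \<le> c * (x \<bullet> x)"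
  shows "norm A \<le> real CARD('n) * (real CARD('n) * c)"
proof (rule norm_matrix_le_entries)
  fix i j
  define e f :: "real^'n" where "e = axis i 1" and "f = axis j 1"
  have fe: "f \<bullet> (A *v e) = e \<bullet> (A *v f)" using sym_mat_inner[OF A, of e f] by (simp add: inner_commute)
  have Aij: "A $ i $ j = e \<bullet> (A *v f)"
    by (simp add: e_def f_def inner_axis' matrix_vector_mul_component inner_axis)
  have "4 * A $ i $ j = (e + f) \<bullet> (A *v (e + f)) - (e - f) \<bullet> (A *v (e - f))"
    by (simp add: Aij matrix_vector_mult_diff_distrib matrix_vector_right_distrib inner_diff_left inner_diff_right
        inner_add_left inner_add_right fe)
  moreover have "(e + f) \<bullet> (A *v (e + f)) \<le> c * ((e + f) \<bullet> (e + f))" "(e - f) \<bullet> (A *v (e - f)) \<le> c * ((e - f) \<bullet> (e - f))"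
    by (rule le)+
  moreover have "0 \<le> (e + f) \<bullet> (A *v (e + f))" "0 \<le> (e - f) \<bullet> (A *v (e - f))" by (rule nn)+
  moreover have c: "0 \<le> c" using order_trans[OF nn[of e] le[of e]] by (simp add: e_def inner_axis)
  \<comment> \<open>The value 4 is attained when i = j; otherwise the squared norms are 2.\<close>
  moreover have "c * ((e + f) \<bullet> (e + f)) \<le> c * 4" "c * ((e - f) \<bullet> (e - f)) \<le> c * 4"
    using c by (auto intro!: mult_left_mono simp: e_def f_def inner_add_left inner_add_right inner_diff_left inner_diff_right inner_axis_axis)
  ultimately show "\<bar>A $ i $ j\<bar> \<le> c" by linarith
qed

lemma loewner_leI:
  assumes "sym_mat A" "sym_mat B" "\<And>x. x \<bullet> (A *v x) \<le> x \<bullet> (B *v x)"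
  shows "loewner_le A B"
  using assms by (simp add: loewner_le_def nonneg_def_def sym_mat_diff quadratic_form_diff)

lemma continuous_on_riccati_rhs:
  fixes S :: "(real^'n::finite^'n) set"
  assumes "\<And>A i. A \<in> S \<Longrightarrow> A $ i $ i \<noteq> 0"
  shows "continuous_on S (riccati_rhs \<alpha> Lam Sig \<theta>)"
proof -
  have tr: "continuous_on S transpose"
    unfolding transpose_def by (intro continuous_intros)
  have ct: "continuous_on S (Ctilde \<theta>)"
  proof -
    have "continuous_on S (\<lambda>A. if i = j then \<theta> $ i / A $ i $ i else 0)" for i j
      using assms by (cases "i = j") (auto intro!: continuous_intros)
    then show ?thesis unfolding Ctilde_def by (intro continuous_on_vec_lambda)
  qed
  note mult = bounded_bilinear.continuous_on[OF bounded_bilinear_matrix_mult]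
  show ?thesis unfolding riccati_rhs_def
    by (intro continuous_intros mult tr ct)
qed

section \<open>Conjugation by the square root of the inverse of \<open>Lam\<close>\<close>

lemma quadratic_form_conjugate:
  assumes "sym_mat R"
  shows "y \<bullet> ((R ** A ** R) *v y) = (R *v y) \<bullet> (A *v (R *v y))"
  by (simp add: matrix_vector_mul_assoc[symmetric] sym_mat_inner[OF assms])

lemma sym_mat_conjugate:
  assumes "sym_mat R" "sym_mat A"
  shows "sym_mat (R ** A ** R)"
  using assms by (simp add: sym_mat_iff_inner matrix_vector_mul_assoc[symmetric])

lemma
  fixes Lam :: "real^'n::finite^'n"
  assumes Lam: "pos_def Lam"
  shows msqrt_inverse_sym: "sym_mat (msqrt (matrix_inv Lam))"
    and msqrt_inverse_conj: "msqrt (matrix_inv Lam) ** Lam ** msqrt (matrix_inv Lam) = mat 1"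
    and msqrt_inverse_cancel: "msqrt (matrix_inv Lam) *v (msqrt (matrix_inv Lam) *v (Lam *v x)) = x"
proof -
  let ?R = "msqrt (matrix_inv Lam)"
  have nn: "nonneg_def (matrix_inv Lam)" using pos_def_imp_nonneg_def pos_def_inverse(3)[OF Lam] by blast
  show "sym_mat ?R" using msqrt_nonneg_def[OF nn] by (simp add: nonneg_def_def)
  \<comment> \<open>For square matrices a one-sided inverse is two-sided, so
    \<open>?R ** Lam\<close> is also a left inverse of \<open>?R\<close>.\<close>
  have "?R ** (?R ** Lam) = mat 1"
    by (simp add: matrix_mul_assoc msqrt_square[OF nn] pos_def_inverse(2)[OF Lam])
  then show "?R ** Lam ** ?R = mat 1" using matrix_left_right_inverse by blast
  show "?R *v (?R *v (Lam *v x)) = x"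
    by (simp add: matrix_vector_mul_assoc matrix_mul_assoc msqrt_square[OF nn] pos_def_inverse(2)[OF Lam])
qed

lemma quadratic_form_msqrt_inverse:
  assumes "pos_def Lam"
  shows "(msqrt (matrix_inv Lam) *v y) \<bullet> (Lam *v (msqrt (matrix_inv Lam) *v y)) = y \<bullet> y"
  using quadratic_form_conjugate[OF msqrt_inverse_sym[OF assms], of y Lam] msqrt_inverse_conj[OF assms] by simp

text \<open>The substitution x = R y, with R the square root of the inverse of \<open>Lam\<close>,
  turns the form of \<open>Sig\<close> into that of \<open>Dmat Lam Sig\<close> and the form of
  \<open>Lam\<close> into the squared norm. Eigenvalue bounds thus compare \<open>Sig\<close> with
  \<open>Lam\<close>.\<close>

lemma
  assumes Lam: "pos_def Lam" and Sig: "nonneg_def Sig"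
  shows min_eig_Dmat_le: "min_eig (Dmat Lam Sig) * (x \<bullet> (Lam *v x)) \<le> x \<bullet> (Sig *v x)"
    and max_eig_Dmat_ge: "x \<bullet> (Sig *v x) \<le> max_eig (Dmat Lam Sig) * (x \<bullet> (Lam *v x))"
    and min_eig_Dmat_nonneg: "0 \<le> min_eig (Dmat Lam Sig)"
    and max_eig_Dmat_nonneg: "0 \<le> max_eig (Dmat Lam Sig)"
proof -
  let ?R = "msqrt (matrix_inv Lam)"
  have sR: "sym_mat ?R" by (rule msqrt_inverse_sym[OF Lam])
  have sD: "sym_mat (Dmat Lam Sig)"
    unfolding Dmat_def using Sig by (intro sym_mat_conjugate sR) (simp add: nonneg_def_def)
  have D: "y \<bullet> (Dmat Lam Sig *v y) = (?R *v y) \<bullet> (Sig *v (?R *v y))" for y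
    unfolding Dmat_def by (rule quadratic_form_conjugate[OF sR])
  define y where "y = ?R *v (Lam *v x)"
  have Ry: "?R *v y = x" by (simp add: y_def msqrt_inverse_cancel[OF Lam])
  have yy: "y \<bullet> y = x \<bullet> (Lam *v x)" using quadratic_form_msqrt_inverse[OF Lam, of y] by (simp add: Ry)
  obtain v where v: "norm v = 1" "Dmat Lam Sig *v v = min_eig (Dmat Lam Sig) *s v"
      "\<And>x. min_eig (Dmat Lam Sig) * (x \<bullet> x) \<le> x \<bullet> (Dmat Lam Sig *v x)"
    using min_eig_eigenvector[OF sD] by blast
  obtain w where w: "norm w = 1" "Dmat Lam Sig *v w = max_eig (Dmat Lam Sig) *s w"
      "\<And>x. x \<bullet> (Dmat Lam Sig *v x) \<le> max_eig (Dmat Lam Sig) * (x \<bullet> x)"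
    using max_eig_eigenvector[OF sD] by blast
  show "min_eig (Dmat Lam Sig) * (x \<bullet> (Lam *v x)) \<le> x \<bullet> (Sig *v x)"
    using v(3)[of y] by (simp add: D Ry yy)
  show "x \<bullet> (Sig *v x) \<le> max_eig (Dmat Lam Sig) * (x \<bullet> (Lam *v x))"
    using w(3)[of y] by (simp add: D Ry yy)
  have nn: "0 \<le> y \<bullet> (Dmat Lam Sig *v y)" for y using Sig by (simp add: D nonneg_def_def)
  show "0 \<le> min_eig (Dmat Lam Sig)"
    using nn[of v] v(1,2) by (simp add: scalar_mult_eq_scaleR dot_square_norm)
  show "0 \<le> max_eig (Dmat Lam Sig)"
    using nn[of w] w(1,2) by (simp add: scalar_mult_eq_scaleR dot_square_norm)
qed

lemma
  assumes "sym_mat A"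
  shows min_eig_le: "min_eig A * (x \<bullet> x) \<le> x \<bullet> (A *v x)"
    and max_eig_ge: "x \<bullet> (A *v x) \<le> max_eig A * (x \<bullet> x)"
  using min_eig_eigenvector[OF assms] max_eig_eigenvector[OF assms] by metis+

lemma min_eig_pos:
  assumes "pos_def A"
  shows "0 < min_eig A"
proof -
  have "sym_mat A" using assms by (simp add: pos_def_def)
  then obtain v where v: "norm v = 1" "A *v v = min_eig A *s v" using min_eig_eigenvector by metis
  then have "v \<noteq> 0" by auto
  then have "0 < v \<bullet> (A *v v)" using assms by (simp add: pos_def_def)
  then show ?thesis using v by (simp add: scalar_mult_eq_scaleR dot_square_norm)
qed

lemma max_eig_pos:
  assumes "pos_def A"
  shows "0 < max_eig A"
proof -
  have "sym_mat A" using assms by (simp add: pos_def_def)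
  then obtain v where v: "norm v = 1" "A *v v = max_eig A *s v" using max_eig_eigenvector by metis
  then have "v \<noteq> 0" by auto
  then have "0 < v \<bullet> (A *v v)" using assms by (simp add: pos_def_def)
  then show ?thesis using v by (simp add: scalar_mult_eq_scaleR dot_square_norm)
qed

lemma min_eig_greatest:
  assumes "sym_mat A" "\<And>x. c * (x \<bullet> x) \<le> x \<bullet> (A *v x)"
  shows "c \<le> min_eig A"
proof -
  obtain v where v: "norm v = 1" "A *v v = min_eig A *s v" using min_eig_eigenvector[OF assms(1)] by metis
  then show ?thesis using assms(2)[of v] by (simp add: scalar_mult_eq_scaleR dot_square_norm)
qed

lemma compact_diag_bounded: "compact {A :: real^'n::finite^'n. norm A \<le> M \<and> (\<forall>i. m \<le> A $ i $ i)}"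
proof -
  have "closed (\<Inter>i. {A :: real^'n^'n. m \<le> A $ i $ i})"
    by (intro closed_INT ballI closed_Collect_le continuous_intros)
  then have "compact (cball 0 M \<inter> (\<Inter>i. {A :: real^'n^'n. m \<le> A $ i $ i}))"
    by (intro compact_Int_closed compact_cball)
  moreover have "cball 0 M \<inter> (\<Inter>i. {A :: real^'n^'n. m \<le> A $ i $ i}) = {A. norm A \<le> M \<and> (\<forall>i. m \<le> A $ i $ i)}"
    by auto
  ultimately show ?thesis by simp
qed

lemma pos_def_scaled_id: "0 < c \<Longrightarrow> pos_def (c *\<^sub>R mat 1 :: real^'n::finite^'n)"
  by (simp add: pos_def_def sym_mat_iff_inner matrix_vector_mult_scaled)

section \<open>The solution family and its limit\<close>

locale riccati_family =
  fixes T \<alpha> :: real and Lam Sig :: "real^'n::finite^'n" and \<theta> :: "real^'n"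
    and C :: "real \<Rightarrow> real \<Rightarrow> real^'n^'n"
  assumes alpha_nonneg: "\<alpha> \<ge> 0"
    and Lam_pd: "pos_def Lam"
    and Sig_nnd: "nonneg_def Sig"
    and theta_nonneg: "\<And>i. \<theta> $ i \<ge> 0"
    and C_sym: "\<And>l t. l > l0 \<alpha> Lam Sig \<theta> \<Longrightarrow> t \<le> T \<Longrightarrow> sym_mat (C l t)"
    and C_ode: "\<And>l t. l > l0 \<alpha> Lam Sig \<theta> \<Longrightarrow> t \<le> T \<Longrightarrow>
        (C l has_vector_derivative riccati_rhs \<alpha> Lam Sig \<theta> (C l t)) (at t within {..T})"
    and C_T: "\<And>l. l > l0 \<alpha> Lam Sig \<theta> \<Longrightarrow> C l T = l *\<^sub>R mat 1"
begin

definition "th = (\<Sum>i\<in>UNIV. \<theta> $ i)"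
definition "rP = sqrt (th\<^sup>2 / 4 + \<alpha> * min_eig (Dmat Lam Sig))"
definition "rQ = sqrt (\<alpha> * max_eig (Dmat Lam Sig))"
text \<open>Adding \<open>th / 2\<close> completes the square: the sum solves u' =
  \<open>u\<^sup>2 - rP\<^sup>2\<close>, and \<open>riccati_sol\<close> applies in the reversed time
  \<open>T - t\<close>.\<close>

definition p where "p l t = riccati_sol rP (l / max_eig Lam + th / 2) (T - t) - th / 2"
definition q where "q l t = riccati_sol rQ (l / min_eig Lam) (T - t)"
abbreviation "L0 \<equiv> l0 \<alpha> Lam Sig \<theta>"
abbreviation "F \<equiv> riccati_rhs \<alpha> Lam Sig \<theta>"

lemma th_nonneg: "0 \<le> th"
  unfolding th_def by (intro sum_nonneg theta_nonneg)

lemma rP_ge: "th / 2 \<le> rP"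
proof -
  have "sqrt ((th / 2)\<^sup>2) \<le> rP"
    unfolding rP_def using alpha_nonneg min_eig_Dmat_nonneg[OF Lam_pd Sig_nnd]
    by (intro real_sqrt_le_mono) (simp add: power2_eq_square)
  then show ?thesis using th_nonneg by simp
qed

lemma rP_nonneg: "0 \<le> rP"
  using rP_ge th_nonneg by linarith

lemma rP_square: "rP\<^sup>2 = th\<^sup>2 / 4 + \<alpha> * min_eig (Dmat Lam Sig)"
  unfolding rP_def using alpha_nonneg min_eig_Dmat_nonneg[OF Lam_pd Sig_nnd] by simp

lemma rQ_nonneg: "0 \<le> rQ"
  unfolding rQ_def using alpha_nonneg max_eig_Dmat_nonneg[OF Lam_pd Sig_nnd] by simp

lemma rQ_square: "rQ\<^sup>2 = \<alpha> * max_eig (Dmat Lam Sig)"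
  unfolding rQ_def using alpha_nonneg max_eig_Dmat_nonneg[OF Lam_pd Sig_nnd] by simp

lemma l0_eq: "L0 = max (max_eig Lam * (rP - th / 2)) (min_eig Lam * rQ)"
  by (simp add: l0_def Let_def th_def rP_def rQ_def)

text \<open>The two arguments of the maximum in \<open>l0\<close> say that the terminal values of p
  and q lie above the equilibria \<open>rP - th / 2\<close> and \<open>rQ\<close>.\<close>

lemma
  assumes "l > L0"
  shows above_l0_P: "rP < l / max_eig Lam + th / 2"
    and above_l0_Q: "rQ < l / min_eig Lam"
    and above_l0_pos: "0 < l"
proof -
  have 1: "max_eig Lam * (rP - th / 2) < l" and 2: "min_eig Lam * rQ < l" using assms by (auto simp: l0_eq)
  show "rP < l / max_eig Lam + th / 2"
    using 1 max_eig_pos[OF Lam_pd] by (simp add: field_simps)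
  show "rQ < l / min_eig Lam" using 2 min_eig_pos[OF Lam_pd] by (simp add: field_simps)
  have "0 \<le> min_eig Lam * rQ" using min_eig_pos[OF Lam_pd] rQ_nonneg by simp
  then show "0 < l" using 2 by linarith
qed

lemma p_ode:
  assumes "l > L0" "t \<le> T"
  shows "(p l has_real_derivative (p l t)\<^sup>2 + th * p l t - \<alpha> * min_eig (Dmat Lam Sig)) (at t within S)"
proof -
  define u where "u = l / max_eig Lam + th / 2"
  have "(riccati_sol rP u has_real_derivative rP\<^sup>2 - (riccati_sol rP u (T - t))\<^sup>2) (at (T - t))"
    using above_l0_P[OF assms(1)] rP_nonneg assms(2) by (intro riccati_sol_has_derivative) (auto simp: u_def)
  moreover have "((\<lambda>t. T - t) has_real_derivative -1) (at t within S)" by (auto intro!: derivative_eq_intros)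
  ultimately have "((\<lambda>t. riccati_sol rP u (T - t)) has_real_derivative (rP\<^sup>2 - (riccati_sol rP u (T - t))\<^sup>2) * -1) (at t within S)"
    by (rule DERIV_chain2)
  then have "(p l has_real_derivative (rP\<^sup>2 - (riccati_sol rP u (T - t))\<^sup>2) * -1) (at t within S)"
    unfolding p_def u_def[symmetric] by (auto intro!: derivative_eq_intros)
  moreover have "(rP\<^sup>2 - (riccati_sol rP u (T - t))\<^sup>2) * -1 = (p l t)\<^sup>2 + th * p l t - \<alpha> * min_eig (Dmat Lam Sig)"
    unfolding p_def u_def[symmetric] rP_square by (simp add: power2_eq_square algebra_simps)
  ultimately show ?thesis by simp
qed

lemma q_ode:
  assumes "l > L0" "t \<le> T"
  shows "(q l has_real_derivative (q l t)\<^sup>2 - \<alpha> * max_eig (Dmat Lam Sig)) (at t within S)"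
proof -
  have "(riccati_sol rQ (l / min_eig Lam) has_real_derivative rQ\<^sup>2 - (riccati_sol rQ (l / min_eig Lam) (T - t))\<^sup>2) (at (T - t))"
    using above_l0_Q[OF assms(1)] rQ_nonneg assms(2) by (intro riccati_sol_has_derivative) auto
  moreover have "((\<lambda>t. T - t) has_real_derivative -1) (at t within S)" by (auto intro!: derivative_eq_intros)
  ultimately have "(q l has_real_derivative (rQ\<^sup>2 - (q l t)\<^sup>2) * -1) (at t within S)"
    unfolding q_def by (rule DERIV_chain2)
  then show ?thesis unfolding rQ_square by simp
qed

lemma p_T: "p l T = l / max_eig Lam"
  by (simp add: p_def riccati_sol_0)

lemma q_T: "q l T = l / min_eig Lam"
  by (simp add: q_def riccati_sol_0)

lemma p_pos: "l > L0 \<Longrightarrow> t \<le> T \<Longrightarrow> 0 < p l t"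
  using riccati_sol_gt[OF rP_nonneg above_l0_P, of l "T - t"] rP_ge by (simp add: p_def)

lemma q_pos: "l > L0 \<Longrightarrow> t \<le> T \<Longrightarrow> 0 < q l t"
  using riccati_sol_gt[OF rQ_nonneg above_l0_Q, of l "T - t"] rQ_nonneg by (simp add: q_def)

lemma q_le: "l > L0 \<Longrightarrow> t < T \<Longrightarrow> q l t \<le> rQ + 1 / (T - t)"
  unfolding q_def using above_l0_Q[of l] rQ_nonneg by (intro riccati_sol_le) auto

section \<open>Multiples of \<open>Lam\<close> as barriers, and monotonicity of the family\<close>

lemma Lam_sym: "sym_mat Lam"
  using Lam_pd by (simp add: pos_def_def)

lemma Lam_form_nonneg: "0 \<le> x \<bullet> (Lam *v x)"
  using pos_def_imp_nonneg_def[OF Lam_pd] by (simp add: nonneg_def_def)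

lemma Lam_diag_pos: "0 < Lam $ i $ i"
proof -
  have "0 < axis i 1 \<bullet> (Lam *v axis i 1)"
    using Lam_pd unfolding pos_def_def by (metis axis_eq_0_iff zero_neq_one)
  then show ?thesis by (simp only: quadratic_form_axis)
qed

lemma C_form_T: "l > L0 \<Longrightarrow> x \<bullet> (C l T *v x) = l * (x \<bullet> x)"
  by (simp add: C_T quadratic_form_scale)

lemma riccati_rhs_Lam:
  assumes "0 < c"
  shows "x \<bullet> (F (c *\<^sub>R Lam) *v x) = c\<^sup>2 * (x \<bullet> (Lam *v x))
    + c * (\<Sum>i\<in>UNIV. \<theta> $ i * (((Lam *v x) $ i)\<^sup>2 / Lam $ i $ i)) - \<alpha> * (x \<bullet> (Sig *v x))"
proof -
  have "matrix_inv Lam *v (Lam *v x) = x"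
    by (simp add: matrix_vector_mul_assoc pos_def_inverse(2)[OF Lam_pd])
  moreover have "\<theta> $ i / (c * Lam $ i $ i) * (c * (Lam *v x) $ i)\<^sup>2 = c * (\<theta> $ i * (((Lam *v x) $ i)\<^sup>2 / Lam $ i $ i))" for i
    using assms Lam_diag_pos[of i] by (simp add: field_simps power2_eq_square)
  ultimately show ?thesis
    unfolding quadratic_form_riccati_rhs[OF sym_mat_scaleR[OF Lam_sym]]
    by (simp add: matrix_vector_mult_scaled matrix_vector_mult_scaleR sum_distrib_left power2_eq_square inner_commute mult.assoc)
qed

lemma C_ode_within:
  assumes "l > L0" "s \<in> {t..T}"
  shows "(C l has_vector_derivative F (C l s)) (at s within {t..T})"
  by (rule has_vector_derivative_within_subset[OF C_ode]) (use assms in auto)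

lemma scaled_Lam_ode:
  assumes "(f has_real_derivative f') (at s within S)"
  shows "((\<lambda>s. f s *\<^sub>R Lam) has_vector_derivative f' *\<^sub>R Lam) (at s within S)"
  using assms unfolding has_real_derivative_iff_has_vector_derivative
  by (rule bounded_linear.has_vector_derivative[OF bounded_linear_scaleR_left])

lemma pos_def_scaled_Lam: "0 < c \<Longrightarrow> pos_def (c *\<^sub>R Lam)"
  using Lam_pd by (simp add: pos_def_def sym_mat_scaleR quadratic_form_scale)

text \<open>\<open>p l s *\<^sub>R Lam\<close> is a subsolution by Cauchy-Schwarz on the
  \<theta>-part and by the lower bound of \<open>Sig\<close> through
  \<open>min_eig (Dmat Lam Sig)\<close>. At time T it lies below l I because \<open>Lam\<close> is
  at most \<open>max_eig Lam\<close> times the identity. Positive definiteness of C, which every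
  later comparison with C as smaller function requires, follows from it.\<close>

lemma C_lower:
  assumes l: "l > L0" and t: "t \<le> T"
  shows "p l t * (x \<bullet> (Lam *v x)) \<le> x \<bullet> (C l t *v x)"
proof -
  let ?k = "\<alpha> * min_eig (Dmat Lam Sig)"
  have "x \<bullet> ((p l t *\<^sub>R Lam) *v x) \<le> x \<bullet> (C l t *v x)"
  proof (rule riccati_comparison[OF alpha_nonneg Lam_pd Sig_nnd theta_nonneg, where a = t and b = T and
        X = "\<lambda>s. p l s *\<^sub>R Lam" and X' = "\<lambda>s. ((p l s)\<^sup>2 + th * p l s - ?k) *\<^sub>R Lam" and Y' = "\<lambda>s. F (C l s)"])
    fix s assume s: "s \<in> {t..T}"
    then show "pos_def (p l s *\<^sub>R Lam)" using p_pos[OF l, of s] by (simp add: pos_def_scaled_Lam)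
    show "sym_mat (C l s)" using C_sym[OF l] s by simp
    show "(C l has_vector_derivative F (C l s)) (at s within {t..T})" using C_ode_within[OF l s] .
    show "((\<lambda>s. p l s *\<^sub>R Lam) has_vector_derivative ((p l s)\<^sup>2 + th * p l s - ?k) *\<^sub>R Lam) (at s within {t..T})"
      using p_ode[OF l] s by (intro scaled_Lam_ode) auto
    fix x
    have "(\<Sum>i\<in>UNIV. \<theta> $ i * (((Lam *v x) $ i)\<^sup>2 / Lam $ i $ i)) \<le> th * (x \<bullet> (Lam *v x))"
      unfolding th_def sum_distrib_right
      by (intro sum_mono mult_left_mono pos_def_cauchy_schwarz_axis Lam_pd theta_nonneg)
    then have "p l s * (\<Sum>i\<in>UNIV. \<theta> $ i * (((Lam *v x) $ i)\<^sup>2 / Lam $ i $ i)) \<le> p l s * (th * (x \<bullet> (Lam *v x)))"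
      using p_pos[OF l, of s] s by (intro mult_left_mono) auto
    moreover have "\<alpha> * (min_eig (Dmat Lam Sig) * (x \<bullet> (Lam *v x))) \<le> \<alpha> * (x \<bullet> (Sig *v x))"
      by (intro mult_left_mono min_eig_Dmat_le Lam_pd Sig_nnd alpha_nonneg)
    moreover have "((p l s)\<^sup>2 + th * p l s - ?k) * (x \<bullet> (Lam *v x)) =
        (p l s)\<^sup>2 * (x \<bullet> (Lam *v x)) + p l s * (th * (x \<bullet> (Lam *v x))) - \<alpha> * (min_eig (Dmat Lam Sig) * (x \<bullet> (Lam *v x)))"
      by (simp add: algebra_simps)
    moreover have "0 < p l s" using p_pos[OF l, of s] s by simp
    ultimately show "x \<bullet> (F (p l s *\<^sub>R Lam) *v x) \<le> x \<bullet> ((((p l s)\<^sup>2 + th * p l s - ?k) *\<^sub>R Lam) *v x)"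
      unfolding quadratic_form_scale by (simp only: riccati_rhs_Lam)
  next
    fix x
    have "l / max_eig Lam * (x \<bullet> (Lam *v x)) \<le> l / max_eig Lam * (max_eig Lam * (x \<bullet> x))"
      using above_l0_pos[OF l] max_eig_pos[OF Lam_pd] by (intro mult_left_mono max_eig_ge[OF Lam_sym]) auto
    then show "x \<bullet> ((p l T *\<^sub>R Lam) *v x) \<le> x \<bullet> (C l T *v x)"
      using max_eig_pos[OF Lam_pd] by (simp add: p_T C_form_T[OF l] quadratic_form_scale)
  qed (use t in auto)
  then show ?thesis by (simp add: quadratic_form_scale)
qed

lemma C_pos_def:
  assumes l: "l > L0" and t: "t \<le> T"
  shows "pos_def (C l t)"
  unfolding pos_def_def
proof (intro conjI allI impI)
  show "sym_mat (C l t)" using C_sym[OF l t] .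
  fix x :: "real^'n" assume "x \<noteq> 0"
  then have "0 < p l t * (x \<bullet> (Lam *v x))" using p_pos[OF l t] Lam_pd by (simp add: pos_def_def)
  then show "0 < x \<bullet> (C l t *v x)" using C_lower[OF l t, of x] by linarith
qed

text \<open>The \<theta>-part is nonnegative and \<open>Sig\<close> is at most
  \<open>max_eig (Dmat Lam Sig)\<close> times \<open>Lam\<close>, so a right-hand side without
  \<theta> makes \<open>q l s *\<^sub>R Lam\<close> a supersolution.\<close>

lemma C_upper:
  assumes l: "l > L0" and t: "t \<le> T"
  shows "x \<bullet> (C l t *v x) \<le> q l t * (x \<bullet> (Lam *v x))"
proof -
  let ?k = "\<alpha> * max_eig (Dmat Lam Sig)"
  have "x \<bullet> (C l t *v x) \<le> x \<bullet> ((q l t *\<^sub>R Lam) *v x)"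
  proof (rule riccati_comparison[OF alpha_nonneg Lam_pd Sig_nnd theta_nonneg, where a = t and b = T and
        Y = "\<lambda>s. q l s *\<^sub>R Lam" and Y' = "\<lambda>s. ((q l s)\<^sup>2 - ?k) *\<^sub>R Lam" and X' = "\<lambda>s. F (C l s)"])
    fix s assume s: "s \<in> {t..T}"
    show "sym_mat (q l s *\<^sub>R Lam)" by (intro sym_mat_scaleR Lam_sym)
    show "pos_def (C l s)" using C_pos_def[OF l] s by simp
    show "(C l has_vector_derivative F (C l s)) (at s within {t..T})" using C_ode_within[OF l s] .
    show "((\<lambda>s. q l s *\<^sub>R Lam) has_vector_derivative ((q l s)\<^sup>2 - ?k) *\<^sub>R Lam) (at s within {t..T})"
      using q_ode[OF l] s by (intro scaled_Lam_ode) auto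
    fix x
    have "0 \<le> (\<Sum>i\<in>UNIV. \<theta> $ i * (((Lam *v x) $ i)\<^sup>2 / Lam $ i $ i))"
      using theta_nonneg less_imp_le[OF Lam_diag_pos] by (intro sum_nonneg mult_nonneg_nonneg divide_nonneg_nonneg) auto
    then have "0 \<le> q l s * (\<Sum>i\<in>UNIV. \<theta> $ i * (((Lam *v x) $ i)\<^sup>2 / Lam $ i $ i))"
      using q_pos[OF l, of s] s by (intro mult_nonneg_nonneg) auto
    moreover have "\<alpha> * (x \<bullet> (Sig *v x)) \<le> \<alpha> * (max_eig (Dmat Lam Sig) * (x \<bullet> (Lam *v x)))"
      by (intro mult_left_mono max_eig_Dmat_ge Lam_pd Sig_nnd alpha_nonneg)
    ultimately show "x \<bullet> ((((q l s)\<^sup>2 - ?k) *\<^sub>R Lam) *v x) \<le> x \<bullet> (F (q l s *\<^sub>R Lam) *v x)"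
      using q_pos[OF l, of s] s by (simp add: riccati_rhs_Lam quadratic_form_scale algebra_simps)
  next
    fix x
    have "l / min_eig Lam * (min_eig Lam * (x \<bullet> x)) \<le> l / min_eig Lam * (x \<bullet> (Lam *v x))"
      using above_l0_pos[OF l] min_eig_pos[OF Lam_pd] by (intro mult_left_mono min_eig_le[OF Lam_sym]) auto
    then show "x \<bullet> (C l T *v x) \<le> x \<bullet> ((q l T *\<^sub>R Lam) *v x)"
      using min_eig_pos[OF Lam_pd] by (simp add: q_T C_form_T[OF l] quadratic_form_scale)
  qed (use t in auto)
  then show ?thesis by (simp add: quadratic_form_scale)
qed

text \<open>The delayed solution solves the same autonomous equation, and \<open>final\<close> is
  the comparison at time T. With \<delta> = 0 this is monotonicity in l; with \<delta> > 0 it holds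
  even for l' much larger than l.\<close>

lemma C_shift_mono:
  assumes l: "l > L0" "l' > L0" and \<delta>: "0 \<le> \<delta>" and t: "t \<le> T - \<delta>"
    and final: "\<And>x. x \<bullet> (C l' (T - \<delta>) *v x) \<le> l * (x \<bullet> x)"
  shows "x \<bullet> (C l' t *v x) \<le> x \<bullet> (C l (t + \<delta>) *v x)"
proof -
  have "x \<bullet> (C l' (t + \<delta> - \<delta>) *v x) \<le> x \<bullet> (C l (t + \<delta>) *v x)"
  proof (rule riccati_comparison[OF alpha_nonneg Lam_pd Sig_nnd theta_nonneg, where a = "t + \<delta>" and b = T and
        X = "\<lambda>s. C l' (s - \<delta>)" and X' = "\<lambda>s. F (C l' (s - \<delta>))" and Y' = "\<lambda>s. F (C l s)"])
    fix s assume s: "s \<in> {t + \<delta>..T}"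
    show "pos_def (C l' (s - \<delta>))" using C_pos_def[OF l(2)] s \<delta> by simp
    show "sym_mat (C l s)" using C_sym[OF l(1)] s by simp
    show "(C l has_vector_derivative F (C l s)) (at s within {t + \<delta>..T})" using C_ode_within[OF l(1) s] .
    have "((\<lambda>s. s - \<delta>) has_vector_derivative 1) (at s within {t + \<delta>..T})"
      by (auto intro!: derivative_eq_intros)
    moreover have "(C l' has_vector_derivative F (C l' (s - \<delta>))) (at (s - \<delta>) within (\<lambda>s. s - \<delta>) ` {t + \<delta>..T})"
      by (rule has_vector_derivative_within_subset[OF C_ode[OF l(2)]]) (use s \<delta> in auto)
    ultimately have "((C l' \<circ> (\<lambda>s. s - \<delta>)) has_vector_derivative 1 *\<^sub>R F (C l' (s - \<delta>))) (at s within {t + \<delta>..T})"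
      by (rule vector_diff_chain_within)
    then show "((\<lambda>s. C l' (s - \<delta>)) has_vector_derivative F (C l' (s - \<delta>))) (at s within {t + \<delta>..T})"
      by (simp add: o_def)
  qed (use t l final in \<open>auto simp: C_form_T\<close>)
  then show ?thesis by simp
qed

lemma C_mono:
  assumes "L0 < l" "l \<le> l'" "t \<le> T"
  shows "x \<bullet> (C l t *v x) \<le> x \<bullet> (C l' t *v x)"
  using C_shift_mono[of l' l 0 t x] assms by (simp add: C_form_T mult_right_mono)

section \<open>Estimates uniform in l away from T\<close>

lemma p_continuous:
  assumes "l > L0"
  shows "continuous_on {..T} (p l)"
  unfolding continuous_on_eq_continuous_within
  by (intro ballI DERIV_continuous[OF p_ode[OF assms]]) simp

text \<open>The norm bound comes from the upper barrier, whose estimate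
  \<open>rQ + 1 / \<epsilon>\<close> is free of l. For the diagonal, monotonicity reduces all l to
  the single member \<open>L0 + 1\<close>, whose lower barrier has a positive minimum on the compact
  interval.\<close>

lemma C_uniform_bounds:
  assumes "0 < \<epsilon>"
  obtains M m where "0 < m"
    "\<And>l t. l \<ge> L0 + 1 \<Longrightarrow> t \<in> {0..T - \<epsilon>} \<Longrightarrow> norm (C l t) \<le> M"
    "\<And>l t i. l \<ge> L0 + 1 \<Longrightarrow> t \<in> {0..T - \<epsilon>} \<Longrightarrow> m \<le> C l t $ i $ i"
proof -
  define c where "c = (rQ + 1 / \<epsilon>) * max_eig Lam"
  have M: "norm (C l t) \<le> real CARD('n) * (real CARD('n) * c)" if l: "l \<ge> L0 + 1" and t: "t \<in> {0..T - \<epsilon>}" for l t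
  proof (rule norm_nonneg_form_le)
    have l': "l > L0" and t': "t \<le> T" using l t assms by auto
    show "sym_mat (C l t)" using C_sym[OF l' t'] .
    fix x :: "real^'n"
    show "0 \<le> x \<bullet> (C l t *v x)"
      using pos_def_imp_nonneg_def[OF C_pos_def[OF l' t']] by (simp add: nonneg_def_def)
    have "1 / (T - t) \<le> 1 / \<epsilon>" using t assms by (intro divide_left_mono) auto
    then have "q l t \<le> rQ + 1 / \<epsilon>" using q_le[OF l', of t] t assms by auto
    then have "q l t * (x \<bullet> (Lam *v x)) \<le> (rQ + 1 / \<epsilon>) * (max_eig Lam * (x \<bullet> x))"
      using q_pos[OF l' t'] by (intro mult_mono max_eig_ge[OF Lam_sym] Lam_form_nonneg) auto
    then show "x \<bullet> (C l t *v x) \<le> c * (x \<bullet> x)"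
      using C_upper[OF l' t', of x] by (simp add: c_def mult.assoc)
  qed
  define l1 where "l1 = L0 + 1"
  have l1: "l1 > L0" by (simp add: l1_def)
  obtain m0 where m0: "m0 > 0" "\<And>t. t \<in> {0..T - \<epsilon>} \<Longrightarrow> m0 \<le> p l1 t"
  \<comment> \<open>The interval is empty when \<epsilon> > T; any positive \<open>m0\<close> then
    works.\<close>
  proof (cases "{0..T - \<epsilon>} = {}")
    case False
    then obtain s where s: "s \<in> {0..T - \<epsilon>}" "\<And>t. t \<in> {0..T - \<epsilon>} \<Longrightarrow> p l1 s \<le> p l1 t"
      using continuous_attains_inf[OF compact_Icc _ continuous_on_subset[OF p_continuous[OF l1]], of 0 "T - \<epsilon>"] assms by auto
    then show ?thesis using that[of "p l1 s"] p_pos[OF l1, of s] assms by auto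
  qed (use that[of 1] in auto)
  define d where "d = Min (range (\<lambda>i. Lam $ i $ i))"
  have "d \<in> range (\<lambda>i. Lam $ i $ i)" unfolding d_def by (intro Min_in) auto
  then have d: "d > 0" using Lam_diag_pos by auto
  have d_le: "d \<le> Lam $ i $ i" for i unfolding d_def by (intro Min_le) auto
  have m: "m0 * d \<le> C l t $ i $ i" if l: "l \<ge> L0 + 1" and t: "t \<in> {0..T - \<epsilon>}" for l t i
  proof -
    have t': "t \<le> T" using t assms by auto
    define e :: "real^'n" where "e = axis i 1"
    have "m0 * d \<le> p l1 t * (Lam $ i $ i)" using m0(1) d d_le[of i] m0(2)[OF t] by (intro mult_mono) linarith+
    also have "\<dots> = p l1 t * (e \<bullet> (Lam *v e))" by (simp only: e_def quadratic_form_axis)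
    also have "\<dots> \<le> e \<bullet> (C l1 t *v e)" by (rule C_lower[OF l1 t'])
    also have "\<dots> \<le> e \<bullet> (C l t *v e)" by (rule C_mono[OF l1 _ t']) (use l in \<open>simp add: l1_def\<close>)
    also have "\<dots> = C l t $ i $ i" by (simp only: e_def quadratic_form_axis)
    finally show ?thesis .
  qed
  show thesis using that[OF _ M m] m0(1) d by simp
qed

text \<open>Compactness makes the right-hand side bounded and uniformly continuous along the whole
  family: the first gives a common Lipschitz constant, the second lets the equation pass to the
  limit.\<close>

lemma compact_trap:
  assumes "0 < \<epsilon>"
  obtains \<K> where "compact \<K>" "continuous_on \<K> F" "\<And>l t. l \<ge> L0 + 1 \<Longrightarrow> t \<in> {0..T - \<epsilon>} \<Longrightarrow> C l t \<in> \<K>"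
proof -
  obtain M m where *: "0 < m"
    "\<And>l t. l \<ge> L0 + 1 \<Longrightarrow> t \<in> {0..T - \<epsilon>} \<Longrightarrow> norm (C l t) \<le> M"
    "\<And>l t i. l \<ge> L0 + 1 \<Longrightarrow> t \<in> {0..T - \<epsilon>} \<Longrightarrow> m \<le> C l t $ i $ i"
    by (rule C_uniform_bounds[OF assms]) (rule that)
  let ?K = "{A :: real^'n^'n. norm A \<le> M \<and> (\<forall>i. m \<le> A $ i $ i)}"
  have "continuous_on ?K F"
  proof (rule continuous_on_riccati_rhs)
    fix A i assume "A \<in> ?K"
    then have "m \<le> A $ i $ i" by blast
    then show "A $ i $ i \<noteq> 0" using *(1) by linarith
  qed
  then show thesis by (rule that[OF compact_diag_bounded]) (use *(2,3) in blast)
qed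

text \<open>The equation is autonomous, so shifting a solution with larger terminal value by a small \<open>\<delta>\<close>
  produces a solution that already lies below \<open>l I\<close> at the terminal time. Two members of the family are thus
  squeezed between \<open>C(l,t)\<close> and \<open>C(l,t+\<delta>)\<close>.\<close>

lemma C_uniformly_Cauchy:
  assumes \<epsilon>: "0 < \<epsilon>" and e: "0 < e"
  obtains L where "\<And>l l' t. L \<le> l \<Longrightarrow> L \<le> l' \<Longrightarrow> t \<in> {0..T - \<epsilon>} \<Longrightarrow> norm (C l' t - C l t) \<le> e"
proof -
  \<comment> \<open>The margin is halved so that the shifted time \<open>t + \<delta>\<close> also
    stays in the trap.\<close>
  obtain \<K> where \<K>: "compact \<K>" "continuous_on \<K> F" "\<And>l t. l \<ge> L0 + 1 \<Longrightarrow> t \<in> {0..T - \<epsilon> / 2} \<Longrightarrow> C l t \<in> \<K>"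
    by (rule compact_trap[OF half_gt_zero[OF \<epsilon>]]) (rule that)
  obtain B where B: "B > 0" "\<And>A. A \<in> \<K> \<Longrightarrow> norm (F A) \<le> B"
    using compact_imp_bounded[OF compact_continuous_image[OF \<K>(2,1)]] unfolding bounded_pos by blast
  obtain b where b: "b > 0" "\<And>(A :: real^'n^'n) x. norm (A *v x) \<le> norm A * norm x * b"
  proof -
    have "bounded_bilinear ((*v) :: real^'n^'n \<Rightarrow> real^'n \<Rightarrow> real^'n)"
      unfolding bilinear_conv_bounded_bilinear[symmetric] bilinear_def
      by (auto intro!: linearI simp: matrix_vector_mult_add_rdistrib matrix_vector_mult_scaled)
    then show thesis using that bounded_bilinear.pos_bounded by blast
  qed
  define n where "n = real CARD('n)"
  have n: "n > 0" by (simp add: n_def)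
  \<comment> \<open>In time \<delta> a solution moves by at most \<open>B * \<delta>\<close>; b
    passes from the matrix norm to the form, and \<open>n * n\<close> back from the form to the
    norm. The product of these is at most e.\<close>
  define \<delta> where "\<delta> = min (\<epsilon> / 2) (e / (n * n * B * b))"
  have \<delta>: "0 < \<delta>" using \<epsilon> e B(1) b(1) n by (auto simp: \<delta>_def)
  have \<delta>_le: "\<delta> \<le> \<epsilon> / 2" "\<delta> \<le> e / (n * n * B * b)" unfolding \<delta>_def by (rule min.cobounded1 min.cobounded2)+
  \<comment> \<open>The second argument dominates the upper barrier at time
    \<open>T - \<delta>\<close> for every l', which is the terminal condition of the shift.\<close>
  define L where "L = max (L0 + 1) ((rQ + 1 / \<delta>) * max_eig Lam)"
  have main: "norm (C l' t - C l t) \<le> e" if l: "L \<le> l" "l \<le> l'" and t: "t \<in> {0..T - \<epsilon>}" for l l' t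
  proof -
    have l1: "l \<ge> L0 + 1" "l > L0" "l' > L0" using l by (auto simp: L_def)
    have t1: "t \<le> T" "t + \<delta> \<le> T" "t \<in> {0..T - \<epsilon> / 2}" "t + \<delta> \<in> {0..T - \<epsilon> / 2}" using t \<delta> \<delta>_le(1) by auto
    have "norm (C l (t + \<delta>) - C l t) \<le> B * norm (t + \<delta> - t)"
    proof (rule differentiable_bound[where S = "{t..t + \<delta>}" and f' = "\<lambda>s h. h *\<^sub>R F (C l s)"])
      fix s assume s: "s \<in> {t..t + \<delta>}"
      show "(C l has_derivative (\<lambda>h. h *\<^sub>R F (C l s))) (at s within {t..t + \<delta>})"
        unfolding has_vector_derivative_def[symmetric]
        by (rule has_vector_derivative_within_subset[OF C_ode[OF l1(2)]]) (use s t1 in auto)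
      have "norm (F (C l s)) \<le> B" using s t1 l1 by (intro B \<K>(3)) auto
      then have "norm (h *\<^sub>R F (C l s)) \<le> B * norm h" for h :: real by (simp add: mult.commute[of B] mult_left_mono)
      then show "onorm (\<lambda>h. h *\<^sub>R F (C l s)) \<le> B" by (rule onorm_le)
    qed (use \<delta> in auto)
    then have dist: "norm (C l (t + \<delta>) - C l t) \<le> B * \<delta>" using \<delta> by simp
    have le: "x \<bullet> ((C l' t - C l t) *v x) \<le> B * \<delta> * b * (x \<bullet> x)" for x
    proof -
      have fin: "x \<bullet> (C l' (T - \<delta>) *v x) \<le> l * (x \<bullet> x)" for x
      proof -
        have "x \<bullet> (C l' (T - \<delta>) *v x) \<le> q l' (T - \<delta>) * (x \<bullet> (Lam *v x))"
          using \<delta> by (intro C_upper l1) auto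
        also have "\<dots> \<le> (rQ + 1 / \<delta>) * (max_eig Lam * (x \<bullet> x))"
          using q_le[OF l1(3), of "T - \<delta>"] q_pos[OF l1(3), of "T - \<delta>"] \<delta>
          by (intro mult_mono max_eig_ge[OF Lam_sym] Lam_form_nonneg) auto
        also have "\<dots> = ((rQ + 1 / \<delta>) * max_eig Lam) * (x \<bullet> x)" by simp
        also have "\<dots> \<le> l * (x \<bullet> x)" using l(1) by (intro mult_right_mono) (auto simp: L_def)
        finally show ?thesis .
      qed
      have "x \<bullet> (C l' t *v x) \<le> x \<bullet> (C l (t + \<delta>) *v x)"
        using \<delta> t1 by (intro C_shift_mono l1 fin) auto
      then have "x \<bullet> ((C l' t - C l t) *v x) \<le> x \<bullet> ((C l (t + \<delta>) - C l t) *v x)"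
        by (simp add: quadratic_form_diff)
      also have "\<dots> \<le> norm x * norm ((C l (t + \<delta>) - C l t) *v x)" by (rule norm_cauchy_schwarz)
      also have "\<dots> \<le> norm x * (norm (C l (t + \<delta>) - C l t) * norm x * b)"
        by (intro mult_left_mono b norm_ge_zero)
      also have "\<dots> \<le> norm x * (B * \<delta> * norm x * b)"
        using dist b(1) by (intro mult_left_mono mult_right_mono) auto
      also have "\<dots> = B * \<delta> * b * (x \<bullet> x)" by (simp add: dot_square_norm power2_eq_square)
      finally show ?thesis .
    qed
    have "norm (C l' t - C l t) \<le> n * (n * (B * \<delta> * b))"
      unfolding n_def
    proof (rule norm_nonneg_form_le)
      show "sym_mat (C l' t - C l t)" using l1 t1 by (intro sym_mat_diff C_sym)
      show "0 \<le> x \<bullet> ((C l' t - C l t) *v x)" for x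
        using C_mono[OF l1(2) l(2) t1(1), of x] by (simp add: quadratic_form_diff)
    qed (rule le)
    also have "\<dots> = (n * n * B * b) * \<delta>" by simp
    also have "\<dots> \<le> e" using \<delta>_le(2) n B(1) b(1) by (simp add: pos_le_divide_eq mult.commute)
    finally show ?thesis .
  qed
  show thesis
  proof (rule that)
    fix l l' t assume "L \<le> l" "L \<le> l'" "t \<in> {0..T - \<epsilon>}"
    then show "norm (C l' t - C l t) \<le> e"
      using main[of l l' t] main[of l' l t] by (cases "l \<le> l'") (auto simp: norm_minus_commute)
  qed
qed

section \<open>The limit and its differential equation\<close>

definition "Clim t = lim (\<lambda>n. C (real n) t)"

lemma Clim_sequence:
  assumes t: "t \<in> {0..<T}"
  shows "(\<lambda>n. C (real n) t) \<longlonglongrightarrow> Clim t"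
proof -
  have "Cauchy (\<lambda>n. C (real n) t)"
  proof (rule CauchyI)
    fix e :: real assume e: "0 < e"
    \<comment> \<open>With \<epsilon> = \<open>T - t\<close> the point t is the right endpoint of
      the interval.\<close>
    obtain L where L: "\<And>l l' s. L \<le> l \<Longrightarrow> L \<le> l' \<Longrightarrow> s \<in> {0..T - (T - t)} \<Longrightarrow> norm (C l' s - C l s) \<le> e / 2"
      by (rule C_uniformly_Cauchy[OF _ half_gt_zero[OF e], of "T - t"]) (use t in simp, rule that)
    obtain N where N: "L \<le> real N" using real_arch_simple by blast
    have "norm (C (real m) t - C (real n) t) < e" if "m \<ge> N" "n \<ge> N" for m n
    proof -
      have "norm (C (real m) t - C (real n) t) \<le> e / 2" using N that t by (intro L) auto
      then show ?thesis using e by linarith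
    qed
    then show "\<exists>N. \<forall>m\<ge>N. \<forall>n\<ge>N. norm (C (real m) t - C (real n) t) < e" by blast
  qed
  then show ?thesis unfolding Clim_def using Cauchy_convergent convergent_LIMSEQ_iff by blast
qed

text \<open>Letting one of the two parameters in the uniform Cauchy estimate run to infinity along
  the integers bounds the distance to the limit, for all real l beyond the threshold.\<close>

lemma Clim_uniform:
  assumes \<epsilon>: "0 < \<epsilon>"
  shows "uniform_limit {0..T - \<epsilon>} C Clim at_top"
proof (rule uniform_limitI)
  fix e :: real assume e: "0 < e"
  obtain L where L: "\<And>l l' t. L \<le> l \<Longrightarrow> L \<le> l' \<Longrightarrow> t \<in> {0..T - \<epsilon>} \<Longrightarrow> norm (C l' t - C l t) \<le> e / 2"
    by (rule C_uniformly_Cauchy[OF \<epsilon> half_gt_zero[OF e]]) (rule that)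
  have "dist (C l t) (Clim t) < e" if l: "l \<ge> L" and t: "t \<in> {0..T - \<epsilon>}" for l t
  proof -
    have "(\<lambda>n. norm (C (real n) t - C l t)) \<longlonglongrightarrow> norm (Clim t - C l t)"
      using t \<epsilon> by (intro tendsto_intros Clim_sequence) auto
    moreover have "\<forall>\<^sub>F n in sequentially. norm (C (real n) t - C l t) \<le> e / 2"
      using eventually_ge_at_top[of "nat \<lceil>L\<rceil>"]
    proof eventually_elim
      case (elim n)
      then have "L \<le> real n" by linarith
      then show ?case using L[OF l _ t] by blast
    qed
    ultimately have "norm (Clim t - C l t) \<le> e / 2" by (rule tendsto_upperbound) simp
    then show ?thesis using e by (simp add: dist_norm norm_minus_commute)
  qed
  then show "\<forall>\<^sub>F l in at_top. \<forall>t\<in>{0..T - \<epsilon>}. dist (C l t) (Clim t) < e"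
    by (intro eventually_mono[OF eventually_ge_at_top[of L]]) blast
qed

lemma Clim_tendsto:
  assumes t: "t \<in> {0..<T}"
  shows "((\<lambda>l. C l t) \<longlongrightarrow> Clim t) at_top"
  using tendsto_uniform_limitI[OF Clim_uniform[of "T - t"], of t] t by auto

lemma Clim_uniform_compact:
  assumes K: "compact K" "K \<subseteq> {0..<T}"
  shows "uniform_limit K C Clim at_top"
proof (cases "K = {}")
  case False
  then obtain m where m: "m \<in> K" "\<And>t. t \<in> K \<Longrightarrow> t \<le> m"
    using compact_attains_sup[OF K(1)] by blast
  have "uniform_limit {0..T - (T - m)} C Clim at_top" using m K by (intro Clim_uniform) auto
  then show ?thesis by (rule uniform_limit_on_subset) (use m K in force)
qed simp

lemma C_le_Clim:
  assumes l: "L0 < l" and t: "t \<in> {0..<T}"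
  shows "x \<bullet> (C l t *v x) \<le> x \<bullet> (Clim t *v x)"
proof (rule tendsto_lowerbound)
  show "((\<lambda>l'. x \<bullet> (C l' t *v x)) \<longlongrightarrow> x \<bullet> (Clim t *v x)) at_top"
    by (rule bounded_linear.tendsto[OF bounded_linear_quadratic_form Clim_tendsto[OF t]])
  show "\<forall>\<^sub>F l' in at_top. x \<bullet> (C l t *v x) \<le> x \<bullet> (C l' t *v x)"
    using eventually_ge_at_top[of l] by eventually_elim (use C_mono[OF l] t in auto)
qed simp

lemma Clim_sym:
  assumes t: "t \<in> {0..<T}"
  shows "sym_mat (Clim t)"
proof -
  have "((\<lambda>l. transpose (C l t)) \<longlongrightarrow> transpose (Clim t)) at_top"
    unfolding transpose_def by (intro tendsto_intros Clim_tendsto[OF t])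
  moreover have "\<forall>\<^sub>F l in at_top. transpose (C l t) = C l t"
    using eventually_gt_at_top[of L0] by eventually_elim (use C_sym t in \<open>auto simp: sym_mat_def\<close>)
  ultimately have "((\<lambda>l. C l t) \<longlongrightarrow> transpose (Clim t)) at_top" by (rule Lim_transform_eventually)
  then show ?thesis unfolding sym_mat_def
    using tendsto_unique[OF _ _ Clim_tendsto[OF t]] trivial_limit_at_top_linorder by blast
qed

text \<open>The derivatives \<open>F (f n s)\<close> converge uniformly, since F is uniformly
  continuous on the trap and the solutions converge uniformly; hence the limit may be differentiated
  termwise.\<close>

lemma Clim_ode:
  assumes t: "t \<in> {0..<T}"
  shows "(Clim has_derivative (\<lambda>h. h *\<^sub>R F (Clim t))) (at t within {0..<T})"
proof -
  \<comment> \<open>\<open>T - \<epsilon>\<close> is the midpoint of t and T, so t is not the right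
    endpoint of S and differentiating within S loses nothing.\<close>
  define \<epsilon> where "\<epsilon> = (T - t) / 2"
  define S where "S = {0..T - \<epsilon>}"
  have \<epsilon>: "\<epsilon> > 0" "t < T - \<epsilon>" using t by (auto simp: \<epsilon>_def field_simps)
  have tS: "t \<in> S" using t \<epsilon> by (simp add: S_def)
  obtain \<K> where \<K>: "compact \<K>" "continuous_on \<K> F" "\<And>l t. l \<ge> L0 + 1 \<Longrightarrow> t \<in> S \<Longrightarrow> C l t \<in> \<K>"
    by (rule compact_trap[OF \<epsilon>(1), folded S_def]) (rule that)
  \<comment> \<open>Starting at \<open>L0 + 1\<close> puts every member of the sequence into the
    trap.\<close>
  define f where "f n = C (L0 + 1 + real n)" for n
  have seq: "filterlim (\<lambda>n. L0 + 1 + real n) at_top sequentially"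
    by (intro filterlim_tendsto_add_at_top[OF tendsto_const] filterlim_real_sequentially)
  have fK: "f n s \<in> \<K>" if "s \<in> S" for n s unfolding f_def using that by (intro \<K>(3)) auto
  have "uniform_limit S f Clim sequentially"
    using filterlim_compose[OF Clim_uniform[OF \<epsilon>(1)] seq] unfolding f_def S_def .
  then have ul: "uniform_limit S (\<lambda>n s. F (f n s)) (\<lambda>s. F (Clim s)) sequentially"
    by (rule uniform_limit_compose_uniformly_continuous_on[OF _ compact_uniformly_continuous[OF \<K>(2,1)]])
       (use fK compact_imp_closed[OF \<K>(1)] in auto)
  have ptw: "(\<lambda>n. f n s) \<longlonglongrightarrow> Clim s" if "s \<in> S" for s
    using filterlim_compose[OF Clim_tendsto seq, of s] that \<epsilon> unfolding f_def S_def by auto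
  have "\<exists>g. \<forall>s\<in>S. (\<lambda>n. f n s) \<longlonglongrightarrow> g s \<and> (g has_derivative (\<lambda>h. h *\<^sub>R F (Clim s))) (at s within S)"
  proof (rule has_derivative_sequence[where f' = "\<lambda>n s h. h *\<^sub>R F (f n s)"])
    show "convex S" by (simp add: S_def)
    show "(f n has_derivative (\<lambda>h. h *\<^sub>R F (f n s))) (at s within S)" if "s \<in> S" for n s
      unfolding f_def has_vector_derivative_def[symmetric]
      by (rule has_vector_derivative_within_subset[OF C_ode]) (use that \<epsilon> in \<open>auto simp: S_def\<close>)
    show "\<forall>\<^sub>F n in sequentially. \<forall>s\<in>S. \<forall>h. norm (h *\<^sub>R F (f n s) - h *\<^sub>R F (Clim s)) \<le> e * norm h" if "e > 0" for e
      using uniform_limitD[OF ul that]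
    proof eventually_elim
      case (elim n)
      show ?case
      proof (intro ballI allI)
        fix s h assume "s \<in> S"
        then have "norm (F (f n s) - F (Clim s)) \<le> e" using elim by (force simp: dist_norm)
        then show "norm (h *\<^sub>R F (f n s) - h *\<^sub>R F (Clim s)) \<le> e * norm h"
          by (simp add: scaleR_diff_right[symmetric] mult.commute[of e] mult_left_mono)
      qed
    qed
  qed (use tS ptw in auto)
  then obtain g where g: "\<And>s. s \<in> S \<Longrightarrow> (\<lambda>n. f n s) \<longlonglongrightarrow> g s"
      "\<And>s. s \<in> S \<Longrightarrow> (g has_derivative (\<lambda>h. h *\<^sub>R F (Clim s))) (at s within S)" by blast
  have "g s = Clim s" if "s \<in> S" for s using LIMSEQ_unique[OF g(1) ptw] that by blast
  then have "(Clim has_derivative (\<lambda>h. h *\<^sub>R F (Clim t))) (at t within S)"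
    using has_derivative_transform[OF tS _ g(2)[OF tS]] by metis
  moreover have "at t within S = at t within {0..<T}"
    by (rule at_within_nhd[where S = "{..<T - \<epsilon>}"]) (use \<epsilon> in \<open>auto simp: S_def\<close>)
  ultimately show ?thesis by simp
qed

section \<open>Blow-up at T and the limits of the barriers\<close>

lemma min_eig_C_T: "filterlim (\<lambda>l. min_eig (C l T)) at_top at_top"
proof (rule filterlim_at_top_mono[OF filterlim_ident])
  show "\<forall>\<^sub>F l in at_top. l \<le> min_eig (C l T)"
    using eventually_gt_at_top[of L0]
  proof eventually_elim
    case (elim l)
    then show ?case by (intro min_eig_greatest C_sym) (auto simp: C_form_T)
  qed
qed

text \<open>A single sufficiently large l suffices for each Z: the limit dominates
  \<open>C l\<close>, hence the lower barrier, and that barrier is continuous up to T with a value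
  large enough there.\<close>

lemma min_eig_Clim:
  assumes "T > 0"
  shows "filterlim (\<lambda>s. min_eig (Clim s)) at_top (at_left T)"
  unfolding filterlim_at_top
proof
  fix Z :: real
  have lmin: "min_eig Lam > 0" and lmax: "max_eig Lam > 0" using min_eig_pos max_eig_pos Lam_pd by auto
  \<comment> \<open>Chosen so that \<open>p l T * min_eig Lam\<close> is at least \<bar>Z\<bar> + 1.
    The extra 1 gives a strict inequality, which survives on a left neighbourhood of T.\<close>
  define l where "l = max (L0 + 1) ((\<bar>Z\<bar> + 1) / min_eig Lam * max_eig Lam)"
  have l: "l > L0" by (simp add: l_def)
  have "(\<bar>Z\<bar> + 1) / min_eig Lam \<le> l / max_eig Lam" using lmax by (simp add: l_def pos_le_divide_eq)
  moreover have "\<bar>Z\<bar> / min_eig Lam < (\<bar>Z\<bar> + 1) / min_eig Lam" using lmin by (simp add: divide_strict_right_mono)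
  ultimately have "\<bar>Z\<bar> / min_eig Lam < p l T" by (simp add: p_T)
  moreover have "(p l \<longlongrightarrow> p l T) (at_left T)"
  proof -
    have "(p l \<longlongrightarrow> p l T) (at T within {..T})"
      using p_continuous[OF l] by (simp add: continuous_on)
    then show ?thesis by (rule tendsto_within_subset) auto
  qed
  ultimately have "\<forall>\<^sub>F s in at_left T. \<bar>Z\<bar> / min_eig Lam < p l s" by (rule order_tendstoD(1)[rotated])
  moreover have "\<forall>\<^sub>F s in at_left T. s \<in> {0<..<T}" using eventually_at_left_real[OF assms] .
  ultimately show "\<forall>\<^sub>F s in at_left T. Z \<le> min_eig (Clim s)"
  proof eventually_elim
    case (elim s)
    have s: "s \<in> {0..<T}" "s \<le> T" using elim by auto
    show ?case
    proof (rule min_eig_greatest[OF Clim_sym[OF s(1)]])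
      fix x :: "real^'n"
      have "\<bar>Z\<bar> \<le> p l s * min_eig Lam" using elim(1) lmin by (simp add: pos_divide_less_eq)
      then have "Z * (x \<bullet> x) \<le> p l s * min_eig Lam * (x \<bullet> x)" by (intro mult_right_mono) auto
      also have "\<dots> = p l s * (min_eig Lam * (x \<bullet> x))" by simp
      also have "\<dots> \<le> p l s * (x \<bullet> (Lam *v x))"
        using p_pos[OF l s(2)] by (intro mult_left_mono min_eig_le[OF Lam_sym]) auto
      also have "\<dots> \<le> x \<bullet> (C l s *v x)" by (rule C_lower[OF l s(2)])
      also have "\<dots> \<le> x \<bullet> (Clim s *v x)" by (rule C_le_Clim[OF l s(1)])
      finally show "Z * (x \<bullet> x) \<le> x \<bullet> (Clim s *v x)" .
    qed
  qed
qed

text \<open>For positive \<open>rP\<close> this is rP coth(rP (T - t)) - th / 2, the solution of the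
  equation for p that is infinite at T.\<close>

definition "plim t = cosh (rP * (T - t)) / sinhc rP (T - t) - th / 2"
definition "qlim t = cosh (rQ * (T - t)) / sinhc rQ (T - t)"

lemma p_tendsto:
  assumes "t < T"
  shows "((\<lambda>l. p l t) \<longlongrightarrow> plim t) at_top"
proof -
  have "filterlim (\<lambda>l. th / 2 + l / max_eig Lam) at_top at_top"
    using max_eig_pos[OF Lam_pd] unfolding divide_inverse
    by (intro filterlim_tendsto_add_at_top[OF tendsto_const] filterlim_at_top_mult_tendsto_pos[OF tendsto_const _ filterlim_ident]) auto
  then have "filterlim (\<lambda>l. l / max_eig Lam + th / 2) at_top at_top" by (simp add: add.commute)
  from filterlim_compose[OF riccati_sol_tendsto[OF rP_nonneg] this] show ?thesis
    unfolding p_def plim_def using assms by (intro tendsto_diff tendsto_const) auto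
qed

lemma q_tendsto:
  assumes "t < T"
  shows "((\<lambda>l. q l t) \<longlongrightarrow> qlim t) at_top"
proof -
  have "filterlim (\<lambda>l. l / min_eig Lam) at_top at_top"
    using min_eig_pos[OF Lam_pd] unfolding divide_inverse
    by (intro filterlim_at_top_mult_tendsto_pos[OF tendsto_const _ filterlim_ident]) auto
  from filterlim_compose[OF riccati_sol_tendsto[OF rQ_nonneg] this] show ?thesis
    unfolding q_def qlim_def using assms by auto
qed

lemma plim_pos: "t < T \<Longrightarrow> 0 < plim t"
  using riccati_limit_gt[OF rP_nonneg, of "T - t"] rP_ge unfolding plim_def by linarith

lemma Clim_lower:
  assumes t: "t \<in> {0..<T}"
  shows "plim t * (x \<bullet> (Lam *v x)) \<le> x \<bullet> (Clim t *v x)"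
proof (rule tendsto_upperbound)
  show "((\<lambda>l. p l t * (x \<bullet> (Lam *v x))) \<longlongrightarrow> plim t * (x \<bullet> (Lam *v x))) at_top"
    using t by (intro tendsto_intros p_tendsto) auto
  show "\<forall>\<^sub>F l in at_top. p l t * (x \<bullet> (Lam *v x)) \<le> x \<bullet> (Clim t *v x)"
    using eventually_gt_at_top[of L0]
  proof eventually_elim
    case (elim l)
    then show ?case using order_trans[OF C_lower[of l t x] C_le_Clim[OF elim t]] t by simp
  qed
qed simp

lemma Clim_upper:
  assumes t: "t \<in> {0..<T}"
  shows "x \<bullet> (Clim t *v x) \<le> qlim t * (x \<bullet> (Lam *v x))"
proof (rule tendsto_le)
  show "((\<lambda>l. q l t * (x \<bullet> (Lam *v x))) \<longlongrightarrow> qlim t * (x \<bullet> (Lam *v x))) at_top"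
    using t by (intro tendsto_intros q_tendsto) auto
  show "((\<lambda>l. x \<bullet> (C l t *v x)) \<longlongrightarrow> x \<bullet> (Clim t *v x)) at_top"
    by (rule bounded_linear.tendsto[OF bounded_linear_quadratic_form Clim_tendsto[OF t]])
  show "\<forall>\<^sub>F l in at_top. x \<bullet> (C l t *v x) \<le> q l t * (x \<bullet> (Lam *v x))"
    using eventually_gt_at_top[of L0] by eventually_elim (use C_upper t in auto)
qed simp

text \<open>Evaluating the barrier inequalities at \<open>R *v x\<close> turns the form of
  \<open>Lam\<close> into that of the identity.\<close>

lemma
  assumes t: "t \<in> {0..<T}"
  defines "R \<equiv> msqrt (matrix_inv Lam)"
  shows plim_loewner_le: "loewner_le (plim t *\<^sub>R mat 1) (R ** Clim t ** R)"
    and qlim_loewner_ge: "loewner_le (R ** Clim t ** R) (qlim t *\<^sub>R mat 1)"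
proof -
  have sR: "sym_mat R" unfolding R_def by (rule msqrt_inverse_sym[OF Lam_pd])
  have id: "sym_mat (c *\<^sub>R mat 1 :: real^'n^'n)" for c by (simp add: sym_mat_iff_inner matrix_vector_mult_scaled)
  have RL: "(R *v x) \<bullet> (Lam *v (R *v x)) = x \<bullet> x" for x
    unfolding R_def by (rule quadratic_form_msqrt_inverse[OF Lam_pd])
  show "loewner_le (plim t *\<^sub>R mat 1) (R ** Clim t ** R)"
  proof (intro loewner_leI id sym_mat_conjugate sR Clim_sym[OF t])
    show "x \<bullet> ((plim t *\<^sub>R mat 1) *v x) \<le> x \<bullet> ((R ** Clim t ** R) *v x)" for x
      using Clim_lower[OF t, of "R *v x"] by (simp add: RL quadratic_form_scale quadratic_form_conjugate[OF sR])
  qed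
  show "loewner_le (R ** Clim t ** R) (qlim t *\<^sub>R mat 1)"
  proof (intro loewner_leI id sym_mat_conjugate sR Clim_sym[OF t])
    show "x \<bullet> ((R ** Clim t ** R) *v x) \<le> x \<bullet> ((qlim t *\<^sub>R mat 1) *v x)" for x
      using Clim_upper[OF t, of "R *v x"] by (simp add: RL quadratic_form_scale quadratic_form_conjugate[OF sR])
  qed
qed

end

theorem theorem3p6:
  fixes T \<alpha> :: real
    and Lam Sig :: "real ^ 'n::finite ^ 'n"
    and \<theta> :: "real ^ 'n"
    and C P Q :: "real \<Rightarrow> real \<Rightarrow> real ^ 'n ^ 'n"
  assumes T_pos: "T > 0"
    and alpha_nonneg: "\<alpha> \<ge> 0"
    and Lam_pd: "pos_def Lam"
    and Sig_nnd: "nonneg_def Sig"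
    and theta_nonneg: "\<And>i. \<theta> $ i \<ge> 0"
    and C_sym: "\<And>l t. l > l0 \<alpha> Lam Sig \<theta> \<Longrightarrow> t \<le> T \<Longrightarrow> sym_mat (C l t)"
    and C_ode: "\<And>l t. l > l0 \<alpha> Lam Sig \<theta> \<Longrightarrow> t \<le> T \<Longrightarrow>
        (C l has_derivative (\<lambda>h. h *\<^sub>R riccati_rhs \<alpha> Lam Sig \<theta> (C l t))) (at t within {..T})"
    and C_T: "\<And>l. l > l0 \<alpha> Lam Sig \<theta> \<Longrightarrow> C l T = l *\<^sub>R mat 1"
    and P_ode: "\<And>l t. l > l0 \<alpha> Lam Sig \<theta> \<Longrightarrow> t \<le> T \<Longrightarrow>
        (P l has_derivative (\<lambda>h. h *\<^sub>R (P l t ** P l t + (\<Sum>i\<in>UNIV. \<theta> $ i) *\<^sub>R P l t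
              - (\<alpha> * min_eig (Dmat Lam Sig)) *\<^sub>R mat 1))) (at t within {..T})"
    and P_T: "\<And>l. l > l0 \<alpha> Lam Sig \<theta> \<Longrightarrow> P l T = (l / max_eig Lam) *\<^sub>R mat 1"
    and Q_ode: "\<And>l t. l > l0 \<alpha> Lam Sig \<theta> \<Longrightarrow> t \<le> T \<Longrightarrow>
        (Q l has_derivative (\<lambda>h. h *\<^sub>R (Q l t ** Q l t
              - (\<alpha> * max_eig (Dmat Lam Sig)) *\<^sub>R mat 1))) (at t within {..T})"
    and Q_T: "\<And>l. l > l0 \<alpha> Lam Sig \<theta> \<Longrightarrow> Q l T = (l / min_eig Lam) *\<^sub>R mat 1"
  shows "\<exists>Clim :: real \<Rightarrow> real ^ 'n ^ 'n.
     \<comment> \<open>(i)\<close>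
     (\<forall>t\<in>{0..<T}. ((\<lambda>l. C l t) \<longlongrightarrow> Clim t) at_top)
   \<and> (\<forall>K. compact K \<and> K \<subseteq> {0..<T} \<longrightarrow> uniform_limit K C Clim at_top)
   \<and> filterlim (\<lambda>l. min_eig (C l T)) at_top at_top
     \<comment> \<open>(ii)\<close>
   \<and> (\<forall>t\<in>{0..<T}. (Clim has_derivative (\<lambda>h. h *\<^sub>R riccati_rhs \<alpha> Lam Sig \<theta> (Clim t)))
                      (at t within {0..<T}))
   \<and> filterlim (\<lambda>s. min_eig (Clim s)) at_top (at_left T)
   \<and> (\<forall>t\<in>{0..<T}. \<exists>Pt Qt.
        ((\<lambda>l. P l t) \<longlongrightarrow> Pt) at_top \<and> ((\<lambda>l. Q l t) \<longlongrightarrow> Qt) at_top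
      \<and> pos_def Pt
      \<and> loewner_le Pt (msqrt (matrix_inv Lam) ** Clim t ** msqrt (matrix_inv Lam))
      \<and> loewner_le (msqrt (matrix_inv Lam) ** Clim t ** msqrt (matrix_inv Lam)) Qt)"
proof -
  interpret riccati_family T \<alpha> Lam Sig \<theta> C
    using alpha_nonneg Lam_pd Sig_nnd theta_nonneg C_sym C_ode C_T
    by unfold_locales (auto simp: has_vector_derivative_def)
  \<comment> \<open>P and Q are given only through their initial value problems; uniqueness
    identifies them with the explicit scalar barriers.\<close>
  have P_eq: "P l t = p l t *\<^sub>R mat 1" if l: "l > L0" and t: "t \<le> T" for l t
  proof (rule matrix_riccati_scalar_solution[OF _ _ _ t])
    show "(P l has_vector_derivative P l s ** P l s + th *\<^sub>R P l s - (\<alpha> * min_eig (Dmat Lam Sig)) *\<^sub>R mat 1) (at s within {..T})"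
      if "s \<le> T" for s
      using P_ode[OF l that] by (simp add: has_vector_derivative_def th_def)
    show "P l T = p l T *\<^sub>R mat 1" by (simp add: P_T[OF l] p_T)
  qed (rule p_ode[OF l])
  have Q_eq: "Q l t = q l t *\<^sub>R mat 1" if l: "l > L0" and t: "t \<le> T" for l t
  \<comment> \<open>The equation for Q is the case without a linear term.\<close>
  proof (rule matrix_riccati_scalar_solution[where c = 0, OF _ _ _ t])
    show "(Q l has_vector_derivative Q l s ** Q l s + 0 *\<^sub>R Q l s - (\<alpha> * max_eig (Dmat Lam Sig)) *\<^sub>R mat 1) (at s within {..T})"
      if "s \<le> T" for s
      using Q_ode[OF l that] by (simp add: has_vector_derivative_def)
    show "Q l T = q l T *\<^sub>R mat 1" by (simp add: Q_T[OF l] q_T)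
  qed (use q_ode[OF l] in simp)
  have P_lim: "((\<lambda>l. P l t) \<longlongrightarrow> plim t *\<^sub>R mat 1) at_top" if t: "t \<in> {0..<T}" for t
  proof (rule Lim_transform_eventually)
    show "((\<lambda>l. p l t *\<^sub>R (mat 1 :: real^'n^'n)) \<longlongrightarrow> plim t *\<^sub>R mat 1) at_top"
      using t by (intro tendsto_intros p_tendsto) auto
    show "\<forall>\<^sub>F l in at_top. p l t *\<^sub>R mat 1 = P l t"
      using eventually_gt_at_top[of L0] by eventually_elim (use P_eq t in auto)
  qed
  have Q_lim: "((\<lambda>l. Q l t) \<longlongrightarrow> qlim t *\<^sub>R mat 1) at_top" if t: "t \<in> {0..<T}" for t
  proof (rule Lim_transform_eventually)
    show "((\<lambda>l. q l t *\<^sub>R (mat 1 :: real^'n^'n)) \<longlongrightarrow> qlim t *\<^sub>R mat 1) at_top"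
      using t by (intro tendsto_intros q_tendsto) auto
    show "\<forall>\<^sub>F l in at_top. q l t *\<^sub>R mat 1 = Q l t"
      using eventually_gt_at_top[of L0] by eventually_elim (use Q_eq t in auto)
  qed
  show ?thesis
  proof (intro exI[of _ Clim] conjI ballI allI impI)
    fix t assume t: "t \<in> {0..<T}"
    show "((\<lambda>l. C l t) \<longlongrightarrow> Clim t) at_top" by (rule Clim_tendsto[OF t])
    show "(Clim has_derivative (\<lambda>h. h *\<^sub>R riccati_rhs \<alpha> Lam Sig \<theta> (Clim t))) (at t within {0..<T})"
      by (rule Clim_ode[OF t])
    have "pos_def (plim t *\<^sub>R mat 1 :: real^'n^'n)"
      using t by (intro pos_def_scaled_id plim_pos) auto
    then show "\<exists>Pt Qt. ((\<lambda>l. P l t) \<longlongrightarrow> Pt) at_top \<and> ((\<lambda>l. Q l t) \<longlongrightarrow> Qt) at_top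
      \<and> pos_def Pt
      \<and> loewner_le Pt (msqrt (matrix_inv Lam) ** Clim t ** msqrt (matrix_inv Lam))
      \<and> loewner_le (msqrt (matrix_inv Lam) ** Clim t ** msqrt (matrix_inv Lam)) Qt"
      using P_lim[OF t] Q_lim[OF t] plim_loewner_le[OF t] qlim_loewner_ge[OF t] by blast
  next
    show "uniform_limit K C Clim at_top" if "compact K \<and> K \<subseteq> {0..<T}" for K
      using Clim_uniform_compact that by blast
  qed (rule min_eig_C_T min_eig_Clim[OF T_pos])+
qed

end
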